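(* Let $A$ be a unital locally $C^*$-algebra, let $B$ be a unital $C^*$-algebra, let $n$ be a positive integer and let $\rho=[\rho_{ij}]_{i,j=1}^n\in CP_\infty^n(A,B)$ be a completely $n$-positive map from $A$ to $B$. Suppose that $\rho_{ii}$, $i\in\{1,\dots,n\}$, are unitarily equivalent pure unital completely positive linear maps from $A$ to $B$, and that for all $i,j\in\{1,\dots,n\}$ with $i\ne j$ one has $\rho_{ij}(1)=0$ and there is a unitary element $u_{ij}$ in $A$ such that $\rho_{ij}(u_{ij})=1$. Then the map $\varphi$ from $A$ to $M_n(B)$ defined by $\varphi(a)=[\rho_{ij}(a)]_{i,j=1}^n$ is an extreme point in the set of all identity preserving completely positive linear maps from $A$ to $M_n(B)$.
   Context: Locally $C^*$-algebra: a complete Hausdorff complex topological $*$-algebra whose topology is determined by its continuous $C^*$-seminorms (a net converges to $0$ iff $p$ of it converges to $0$ for every continuous $C^*$-seminorm $p$). $M_n(A)$ denotes $n\times n$ matrices over $A$, again a locally $C^*$-algebra with the product topology. $\mathcal{L}_B(E,F)$ denotes the adjointable module homomorphisms between Hilbert $B$-modules $E$ and $F$, and $\mathcal{L}_B(E)=\mathcal{L}_B(E,E)$. The unital $C^*$-algebra $B$ is a Hilbert $B$-module via $\langle a,b\rangle=a^*b$, and $B$ is identified with $\mathcal{L}_B(B)$. A representation of $A$ on a Hilbert $B$-module $F$ is a $*$-morphism $A\to\mathcal{L}_B(F)$. A completely $n$-positive map from $A$ to a locally $C^*$-algebra $C$ is a matrix $\rho=[\rho_{ij}]_{i,j=1}^n$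 of continuous linear maps $\rho_{ij}:A\to C$ such that $[a_{ij}]\mapsto[\rho_{ij}(a_{ij})]$ is a completely positive map $M_n(A)\to M_n(C)$. $CP_\infty^n(A,C)$ is the set of these maps; completely positive linear maps on $A$ are completely $1$-positive maps (in particular continuous). For $\theta,\rho\in CP_\infty^n(A,C)$, $\theta\le\rho$ means $\rho-\theta\in CP_\infty^n(A,C)$. A map $\rho$ is pure if for every completely $n$-positive $\theta\le\rho$ there is a number $\alpha\ge0$ with $\theta=\alpha\rho$ (for the maps $\rho_{ii}$ this is used with $n=1$). For a completely positive map $\sigma:A\to\mathcal{L}_B(E)$ ($A$ unital) the KSGNS construction gives a triple $(\Phi_\sigma,E_\sigma,V_\sigma)$, unique up to unitary equivalence, where $\Phi_\sigma$ is a representation of $A$ on a Hilbert $B$-module $E_\sigma$, $V_\sigma\in\mathcal{L}_B(E,E_\sigma)$, $\sigma(a)=V_\sigma^*\Phi_\sigma(a)V_\sigma$ for all $a\in A$, and $\{\Phi_\sigma(a)V_\sigma x:a\in A,x\in E\}$ spans a dense subspace of $E_\sigma$. Two such maps $\sigma,\tau$ are unitarily equivalent if the representations $\Phi_\sigma,\Phi_\tau$ are unitarily equivalent, i.e. there is a unitary $U\in\mathcal{L}_B(E_\sigma,E_\tau)$ with $U\Phi_\sigma(a)=\Phi_\tau(a)U$ for all $a\in A$. *)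

theory Defs
  imports "HOL-Analysis.Analysis" "HOL-Library.Function_Algebras"
begin

section \<open>Unital complex *-algebras\<close>

class complex_vector = real_vector +
  fixes scaleC :: "complex \<Rightarrow> 'a \<Rightarrow> 'a"  (infixr \<open>*\<^sub>C\<close> 75)
  assumes scaleC_add_right: "c *\<^sub>C (x + y) = c *\<^sub>C x + c *\<^sub>C y"
    and scaleC_add_left: "(c + d) *\<^sub>C x = c *\<^sub>C x + d *\<^sub>C x"
    and scaleC_scaleC: "c *\<^sub>C (d *\<^sub>C x) = (c * d) *\<^sub>C x"
    and scaleC_one: "1 *\<^sub>C x = x"
    and scaleR_scaleC: "r *\<^sub>R x = complex_of_real r *\<^sub>C x"

global_interpretation complex_vector:
  vector_space "scaleC :: complex \<Rightarrow> 'a \<Rightarrow> 'a::complex_vector"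
  defines csubspace = complex_vector.subspace
    and cspan = complex_vector.span
  by unfold_locales
    (simp_all add: scaleC_add_right scaleC_add_left scaleC_scaleC scaleC_one)

text \<open>The unit is provided by \<^class>\<open>monoid_mult\<close> rather than by \<^class>\<open>ring_1\<close>, so that the zero
  algebra is not excluded.\<close>

class complex_star_algebra = complex_vector + real_algebra + monoid_mult +
  fixes star :: "'a \<Rightarrow> 'a"
  assumes scaleC_mult_left: "(c *\<^sub>C x) * y = c *\<^sub>C (x * y)"
    and scaleC_mult_right: "x * (c *\<^sub>C y) = c *\<^sub>C (x * y)"
    and star_star: "star (star x) = x"
    and star_add: "star (x + y) = star x + star y"
    and star_scaleC: "star (c *\<^sub>C x) = cnj c *\<^sub>C star x"
    and star_mult: "star (x * y) = star y * star x"

lemma star_one [simp]: "star (1 :: 'a::complex_star_algebra) = 1"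
  by (metis mult_1 mult_1_right star_mult star_star)

lemma star_zero [simp]: "star (0 :: 'a::complex_star_algebra) = 0"
  by (metis add_cancel_right_right star_add)

lemma star_sum: "star (\<Sum>k\<in>S. f k) = (\<Sum>k\<in>S. star (f k :: 'a::complex_star_algebra))"
  by (induction S rule: infinite_finite_induct) (simp_all add: star_add)

definition unitary :: "'a::complex_star_algebra \<Rightarrow> bool" where
  "unitary u \<longleftrightarrow> star u * u = 1 \<and> u * star u = 1"

text \<open>Positivity of \<open>a\<close> is \<open>a = b\<^sup>* b\<close> throughout.\<close>

definition positive :: "'a::complex_star_algebra \<Rightarrow> bool" where
  "positive a \<longleftrightarrow> (\<exists>b. a = star b * b)"


section \<open>C*-algebras and locally C*-algebras\<close>

class cstar_algebra = complex_star_algebra + real_normed_algebra + banach +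
  assumes norm_scaleC: "norm (c *\<^sub>C x) = cmod c * norm x"
    and norm_star_mult_self: "norm (star x * x) = (norm x)\<^sup>2"

definition (in complex_star_algebra) cstar_seminorm :: "('a \<Rightarrow> real) \<Rightarrow> bool" where
  "cstar_seminorm p \<longleftrightarrow>
     (\<forall>x. 0 \<le> p x) \<and>
     (\<forall>x y. p (x + y) \<le> p x + p y) \<and>
     (\<forall>c x. p (c *\<^sub>C x) = cmod c * p x) \<and>
     (\<forall>x y. p (x * y) \<le> p x * p y) \<and>
     (\<forall>x. p (star x) = p x) \<and>
     (\<forall>x. p (star x * x) = (p x)\<^sup>2)"

class topological_star_algebra =
  complex_star_algebra + topological_ab_group_add + topological_semigroup_mult +
  assumes tendsto_scaleC_Pair:
      "((\<lambda>z. fst z *\<^sub>C snd z) \<longlongrightarrow> c *\<^sub>C a) (nhds c \<times>\<^sub>F nhds a)"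
    and tendsto_star: "(star \<longlongrightarrow> star a) (nhds a)"

text \<open>Nets are replaced by filters. Completeness refers to the uniformity of the additive group:
  \<^class>\<open>uniform_topological_group_add\<close> forces the uniformity to be the one induced by the
  topology.\<close>

class locally_cstar_algebra =
  topological_star_algebra + t2_space + uniform_topological_group_add + complete_uniform_space +
  assumes tendsto_zero_iff_seminorms:
    "F \<le> nhds 0 \<longleftrightarrow>
       (\<forall>p. cstar_seminorm p \<and> (\<forall>x. (p \<longlongrightarrow> p x) (nhds x)) \<longrightarrow> (p \<longlongrightarrow> 0) F)"


lemma norm_star [simp]: "norm (star x) = norm (x :: 'a::cstar_algebra)"
proof -
  have le: "norm y \<le> norm (star y)" for y :: 'a
  proof (cases "norm y = 0")
    case False
    have "norm y * norm y \<le> norm (star y) * norm y"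
      using norm_mult_ineq[of "star y" y] by (simp add: norm_star_mult_self power2_eq_square)
    then show ?thesis using False by simp
  qed simp
  show ?thesis
    using le[of x] le[of "star x"] by (simp add: star_star)
qed

lemma cstar_seminorm_norm: "cstar_seminorm (norm :: 'a::cstar_algebra \<Rightarrow> real)"
  by (simp add: cstar_seminorm_def norm_triangle_ineq norm_scaleC norm_mult_ineq norm_star_mult_self)

lemma bounded_linear_star: "bounded_linear (star :: 'a::cstar_algebra \<Rightarrow> 'a)"
  by (rule bounded_linear_intro[where K = 1]) (simp_all add: star_add scaleR_scaleC star_scaleC)

lemma bounded_bilinear_scaleC: "bounded_bilinear (scaleC :: complex \<Rightarrow> 'a \<Rightarrow> 'a::cstar_algebra)"
  by (rule bounded_bilinear.intro)
     (auto simp: scaleC_add_left scaleC_add_right scaleR_scaleC scaleC_scaleC norm_scaleC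
        scaleR_conv_of_real mult.commute intro!: exI[of _ 1])

instance cstar_algebra \<subseteq> uniform_topological_group_add ..

instance cstar_algebra \<subseteq> locally_cstar_algebra
proof
  fix c :: complex and a :: 'a and F :: "'a filter"
  show "((\<lambda>z. fst z *\<^sub>C snd z) \<longlongrightarrow> c *\<^sub>C a) (nhds c \<times>\<^sub>F nhds a)"
    by (intro bounded_bilinear.tendsto[OF bounded_bilinear_scaleC] filterlim_fst filterlim_snd)
  show "(star \<longlongrightarrow> star a) (nhds a)"
    by (rule bounded_linear.tendsto[OF bounded_linear_star filterlim_ident])
  show "F \<le> nhds 0 \<longleftrightarrow>
       (\<forall>p. cstar_seminorm p \<and> (\<forall>x. (p \<longlongrightarrow> p x) (nhds x)) \<longrightarrow> (p \<longlongrightarrow> 0) F)"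
  proof safe
    fix p :: "'a \<Rightarrow> real"
    assume F: "F \<le> nhds 0" and p: "cstar_seminorm p" "\<forall>x. (p \<longlongrightarrow> p x) (nhds x)"
    have "p (0 *\<^sub>C 0) = cmod 0 * p 0"
      using p(1) unfolding cstar_seminorm_def by blast
    then have "p 0 = 0" by simp
    then show "(p \<longlongrightarrow> 0) F"
      using p(2) F by (metis filterlim_mono order_refl)
  next
    assume *: "\<forall>p. cstar_seminorm p \<and> (\<forall>x. (p \<longlongrightarrow> p x) (nhds x)) \<longrightarrow> (p \<longlongrightarrow> 0) F"
    have "(norm \<longlongrightarrow> 0) F"
      using * cstar_seminorm_norm tendsto_norm[OF filterlim_ident] by blast
    then have "((\<lambda>x. x) \<longlongrightarrow> 0) F"
      by (rule tendsto_norm_zero_cancel)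
    then show "F \<le> nhds 0"
      by (simp add: filterlim_def)
  qed
qed


section \<open>Matrix algebras\<close>

text \<open>A separate type for \<open>M\<^sub>n(A)\<close>, because multiplication on \<^typ>\<open>'a^'n^'n\<close> is
  entrywise. Addition, scalar multiplication and the (product) topology are those of
  \<^typ>\<open>'a^'n^'n\<close>.\<close>

typedef ('a, 'n) sqmat = "UNIV :: ('a^'n^'n) set"
  morphisms rows_of of_rows ..

setup_lifting type_definition_sqmat

lift_definition Mat :: "('n \<Rightarrow> 'n \<Rightarrow> 'a) \<Rightarrow> ('a, 'n::finite) sqmat"
  is "\<lambda>f. \<chi> i j. f i j" .

lift_definition entry :: "('a, 'n::finite) sqmat \<Rightarrow> 'n \<Rightarrow> 'n \<Rightarrow> 'a"
  is "\<lambda>X i j. X $ i $ j" .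

lemma entry_Mat [simp]: "entry (Mat f) i j = f i j"
  by transfer simp

lemma sqmat_eq_iff: "X = Y \<longleftrightarrow> (\<forall>i j. entry X i j = entry Y i j)"
  by transfer (simp add: vec_eq_iff)

instantiation sqmat :: (complex_star_algebra, finite) complex_star_algebra
begin

lift_definition zero_sqmat :: "('a, 'b) sqmat" is 0 .
lift_definition plus_sqmat :: "('a, 'b) sqmat \<Rightarrow> ('a, 'b) sqmat \<Rightarrow> ('a, 'b) sqmat" is "(+)" .
lift_definition minus_sqmat :: "('a, 'b) sqmat \<Rightarrow> ('a, 'b) sqmat \<Rightarrow> ('a, 'b) sqmat" is "(-)" .
lift_definition uminus_sqmat :: "('a, 'b) sqmat \<Rightarrow> ('a, 'b) sqmat" is uminus .
lift_definition scaleR_sqmat :: "real \<Rightarrow> ('a, 'b) sqmat \<Rightarrow> ('a, 'b) sqmat" is "(*\<^sub>R)" .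

definition one_sqmat :: "('a, 'b) sqmat" where
  "1 = Mat (\<lambda>i j. if i = j then 1 else 0)"
definition times_sqmat :: "('a, 'b) sqmat \<Rightarrow> ('a, 'b) sqmat \<Rightarrow> ('a, 'b) sqmat" where
  "X * Y = Mat (\<lambda>i j. \<Sum>k\<in>UNIV. entry X i k * entry Y k j)"
definition scaleC_sqmat :: "complex \<Rightarrow> ('a, 'b) sqmat \<Rightarrow> ('a, 'b) sqmat" where
  "c *\<^sub>C X = Mat (\<lambda>i j. c *\<^sub>C entry X i j)"
definition star_sqmat :: "('a, 'b) sqmat \<Rightarrow> ('a, 'b) sqmat" where
  "star X = Mat (\<lambda>i j. star (entry X j i))"

lemma entry_zero: "entry (0 :: ('a, 'b) sqmat) i j = 0"
  and entry_plus: "entry (X + Y :: ('a, 'b) sqmat) i j = entry X i j + entry Y i j"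
  and entry_minus: "entry (X - Y :: ('a, 'b) sqmat) i j = entry X i j - entry Y i j"
  and entry_uminus: "entry (- X :: ('a, 'b) sqmat) i j = - entry X i j"
  and entry_scaleR: "entry (r *\<^sub>R X :: ('a, 'b) sqmat) i j = r *\<^sub>R entry X i j"
  by (transfer; simp)+

lemma entry_one: "entry (1 :: ('a, 'b) sqmat) i j = (if i = j then 1 else 0)"
  and entry_times: "entry (X * Y :: ('a, 'b) sqmat) i j = (\<Sum>k\<in>UNIV. entry X i k * entry Y k j)"
  and entry_scaleC: "entry (c *\<^sub>C X :: ('a, 'b) sqmat) i j = c *\<^sub>C entry X i j"
  and entry_star: "entry (star X :: ('a, 'b) sqmat) i j = star (entry X j i)"
  by (simp_all add: one_sqmat_def times_sqmat_def scaleC_sqmat_def star_sqmat_def)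

instance
proof
  fix X Y Z :: "('a, 'b) sqmat" and c d :: complex and r s :: real
  show "X * Y * Z = X * (Y * Z)"
    unfolding sqmat_eq_iff entry_times sum_distrib_left sum_distrib_right mult.assoc
    by (intro allI) (rule sum.swap)
  show "1 * X = X"
    by (auto simp: sqmat_eq_iff entry_times entry_one if_distrib[where f = "\<lambda>x. x * _"] cong: if_cong)
  show "X * 1 = X"
    by (auto simp: sqmat_eq_iff entry_times entry_one if_distrib[where f = "\<lambda>x. _ * x"] cong: if_cong)
qed (simp_all add: sqmat_eq_iff entry_zero entry_plus entry_minus entry_uminus entry_scaleR
      entry_times entry_scaleC entry_star algebra_simps scaleC_add_right scaleC_add_left
      scaleC_scaleC scaleC_one scaleR_scaleC star_sum star_star star_add star_scaleC star_mult
      sum.distrib scaleC_mult_left scaleC_mult_right complex_vector.scale_sum_right)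

end

instantiation sqmat :: (topological_space, finite) topological_space
begin

lift_definition open_sqmat :: "('a, 'b) sqmat set \<Rightarrow> bool" is "open :: ('a^'b^'b) set \<Rightarrow> bool" .

instance
  by standard (transfer; auto)+

end


section \<open>Completely positive and completely \<open>n\<close>-positive maps\<close>

text \<open>Since the size \<open>m\<close> is quantified over, the algebra \<open>M\<^sub>m(A)\<close> appears here as the
  functions \<open>nat \<Rightarrow> nat \<Rightarrow> 'a\<close>, of which only the entries with indices below \<open>m\<close> matter;
  \<open>positive_matrix m X\<close> says \<open>X = Y\<^sup>* Y\<close> for some \<open>Y\<close> in \<open>M\<^sub>m(A)\<close>.\<close>

definition positive_matrix :: "nat \<Rightarrow> (nat \<Rightarrow> nat \<Rightarrow> 'a::complex_star_algebra) \<Rightarrow> bool" where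
  "positive_matrix m X \<longleftrightarrow>
     (\<exists>Y. \<forall>i<m. \<forall>j<m. X i j = (\<Sum>k<m. star (Y k i) * Y k j))"

definition completely_positive ::
  "('a::{complex_star_algebra, topological_space} \<Rightarrow>
    'c::{complex_star_algebra, topological_space}) \<Rightarrow> bool" where
  "completely_positive f \<longleftrightarrow>
     Vector_Spaces.linear (*\<^sub>C) (*\<^sub>C) f \<and>
     continuous_on UNIV f \<and>
     (\<forall>m X. positive_matrix m X \<longrightarrow> positive_matrix m (\<lambda>i j. f (X i j)))"

definition completely_n_positive ::
  "('n::finite \<Rightarrow> 'n \<Rightarrow> 'a::{complex_star_algebra, topological_space} \<Rightarrow>
    'c::{complex_star_algebra, topological_space}) \<Rightarrow> bool" where
  "completely_n_positive \<rho> \<longleftrightarrow>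
     (\<forall>i j. Vector_Spaces.linear (*\<^sub>C) (*\<^sub>C) (\<rho> i j) \<and> continuous_on UNIV (\<rho> i j)) \<and>
     completely_positive (\<lambda>X :: ('a, 'n) sqmat. Mat (\<lambda>i j. \<rho> i j (entry X i j)))"

definition cp_le ::
  "('a::{complex_star_algebra, topological_space} \<Rightarrow>
    'c::{complex_star_algebra, topological_space}) \<Rightarrow> ('a \<Rightarrow> 'c) \<Rightarrow> bool" where
  "cp_le \<theta> \<sigma> \<longleftrightarrow> completely_positive (\<lambda>a. \<sigma> a - \<theta> a)"

definition pure_cp ::
  "('a::{complex_star_algebra, topological_space} \<Rightarrow>
    'c::{complex_star_algebra, topological_space}) \<Rightarrow> bool" where
  "pure_cp \<sigma> \<longleftrightarrow>
     (\<forall>\<theta>. completely_positive \<theta> \<and> cp_le \<theta> \<sigma> \<longrightarrow> (\<exists>\<alpha>\<ge>0. \<forall>a. \<theta> a = \<alpha> *\<^sub>R \<sigma> a))"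


section \<open>Hilbert modules\<close>

text \<open>A right Hilbert module is carried by a complex subspace of an ambient vector space
  \<^typ>\<open>'e\<close>, from which it takes its addition and scalar multiplication. Maps between modules are
  only considered on the carriers.\<close>

record ('e, 'b) hmod =
  carrier :: "'e set"
  act :: "'e \<Rightarrow> 'b \<Rightarrow> 'e"
  ip :: "'e \<Rightarrow> 'e \<Rightarrow> 'b"

definition hnorm :: "('e, 'b::cstar_algebra) hmod \<Rightarrow> 'e \<Rightarrow> real" where
  "hnorm E x = sqrt (norm (ip E x x))"

locale hilbert_module =
  fixes E :: "('e::complex_vector, 'b::cstar_algebra) hmod"
  assumes subspace: "csubspace (carrier E)"
    and act_closed: "x \<in> carrier E \<Longrightarrow> act E x b \<in> carrier E"
    and act_add_left: "x \<in> carrier E \<Longrightarrow> y \<in> carrier E \<Longrightarrow> act E (x + y) b = act E x b + act E y b"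
    and act_add_right: "x \<in> carrier E \<Longrightarrow> act E x (b + c) = act E x b + act E x c"
    and act_act: "x \<in> carrier E \<Longrightarrow> act E (act E x b) c = act E x (b * c)"
    and act_one: "x \<in> carrier E \<Longrightarrow> act E x 1 = x"
    and act_scaleC_left: "x \<in> carrier E \<Longrightarrow> act E (z *\<^sub>C x) b = z *\<^sub>C act E x b"
    and act_scaleC_right: "x \<in> carrier E \<Longrightarrow> act E x (z *\<^sub>C b) = z *\<^sub>C act E x b"
    and ip_add_right: "x \<in> carrier E \<Longrightarrow> y \<in> carrier E \<Longrightarrow> y' \<in> carrier E \<Longrightarrow>
      ip E x (y + y') = ip E x y + ip E x y'"
    and ip_scaleC_right: "x \<in> carrier E \<Longrightarrow> y \<in> carrier E \<Longrightarrow> ip E x (z *\<^sub>C y) = z *\<^sub>C ip E x y"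
    and ip_act_right: "x \<in> carrier E \<Longrightarrow> y \<in> carrier E \<Longrightarrow> ip E x (act E y b) = ip E x y * b"
    and ip_star: "x \<in> carrier E \<Longrightarrow> y \<in> carrier E \<Longrightarrow> ip E y x = star (ip E x y)"
    and ip_positive: "x \<in> carrier E \<Longrightarrow> positive (ip E x x)"
    and ip_definite: "x \<in> carrier E \<Longrightarrow> ip E x x = 0 \<Longrightarrow> x = 0"
    and complete: "(\<And>k. X k \<in> carrier E) \<Longrightarrow>
      (\<And>e. e > 0 \<Longrightarrow> \<exists>N. \<forall>k\<ge>N. \<forall>l\<ge>N. hnorm E (X k - X l) < e) \<Longrightarrow>
      \<exists>x\<in>carrier E. (\<lambda>k. hnorm E (X k - x)) \<longlonglongrightarrow> 0"

definition self_module :: "('b::cstar_algebra, 'b) hmod" where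
  "self_module = \<lparr>carrier = UNIV, act = (*), ip = (\<lambda>a b. star a * b)\<rparr>"

lemma hilbert_module_self_module: "hilbert_module (self_module :: ('b::cstar_algebra, 'b) hmod)"
proof
  fix X :: "nat \<Rightarrow> 'b"
  have n: "hnorm self_module x = norm x" for x :: 'b
    by (simp add: hnorm_def self_module_def norm_star_mult_self)
  assume "\<And>e. e > 0 \<Longrightarrow> \<exists>N. \<forall>k\<ge>N. \<forall>l\<ge>N. hnorm self_module (X k - X l) < e"
  then have "Cauchy X"
    by (simp add: n Cauchy_def dist_norm)
  then obtain x where "X \<longlonglongrightarrow> x"
    using Cauchy_convergent_iff convergent_def by blast
  then show "\<exists>x\<in>carrier self_module. (\<lambda>k. hnorm self_module (X k - x)) \<longlonglongrightarrow> 0"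
    unfolding n by (intro bexI[of _ x] tendsto_norm_zero LIM_zero) (simp_all add: self_module_def)
next
  fix x :: 'b
  assume "ip self_module x x = 0"
  then have "norm (star x * x) = 0"
    by (simp add: self_module_def)
  then show "x = 0"
    by (simp add: norm_star_mult_self)
next
  fix x :: 'b
  show "positive (ip self_module x x)"
    unfolding positive_def self_module_def by (auto intro: exI[of _ x])
qed (simp_all add: self_module_def complex_vector.subspace_def distrib_left distrib_right
      mult.assoc scaleC_mult_left scaleC_mult_right star_mult star_star)

definition module_hom_on ::
  "('e::complex_vector, 'b) hmod \<Rightarrow> ('f::complex_vector, 'b) hmod \<Rightarrow> ('e \<Rightarrow> 'f) \<Rightarrow> bool" where
  "module_hom_on E F T \<longleftrightarrow>
     (\<forall>x\<in>carrier E. T x \<in> carrier F) \<and>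
     (\<forall>x\<in>carrier E. \<forall>y\<in>carrier E. T (x + y) = T x + T y) \<and>
     (\<forall>x\<in>carrier E. \<forall>z. T (z *\<^sub>C x) = z *\<^sub>C T x) \<and>
     (\<forall>x\<in>carrier E. \<forall>b. T (act E x b) = act F (T x) b)"

definition adjoint_on ::
  "('e::complex_vector, 'b) hmod \<Rightarrow> ('f::complex_vector, 'b) hmod \<Rightarrow>
    ('e \<Rightarrow> 'f) \<Rightarrow> ('f \<Rightarrow> 'e) \<Rightarrow> bool" where
  "adjoint_on E F T S \<longleftrightarrow>
     module_hom_on E F T \<and> module_hom_on F E S \<and>
     (\<forall>x\<in>carrier E. \<forall>y\<in>carrier F. ip F (T x) y = ip E x (S y))"

text \<open>The space \<open>\<L>\<^sub>B(E, F)\<close>.\<close>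

definition adjointable ::
  "('e::complex_vector, 'b) hmod \<Rightarrow> ('f::complex_vector, 'b) hmod \<Rightarrow> ('e \<Rightarrow> 'f) \<Rightarrow> bool" where
  "adjointable E F T \<longleftrightarrow> (\<exists>S. adjoint_on E F T S)"

definition unitary_on ::
  "('e::complex_vector, 'b) hmod \<Rightarrow> ('f::complex_vector, 'b) hmod \<Rightarrow> ('e \<Rightarrow> 'f) \<Rightarrow> bool" where
  "unitary_on E F U \<longleftrightarrow>
     (\<exists>S. adjoint_on E F U S \<and>
          (\<forall>x\<in>carrier E. S (U x) = x) \<and> (\<forall>y\<in>carrier F. U (S y) = y))"

definition representation_on ::
  "('f::complex_vector, 'b) hmod \<Rightarrow> ('a::complex_star_algebra \<Rightarrow> 'f \<Rightarrow> 'f) \<Rightarrow> bool" where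
  "representation_on F \<Phi> \<longleftrightarrow>
     (\<forall>a. adjoint_on F F (\<Phi> a) (\<Phi> (star a))) \<and>
     (\<forall>a b. \<forall>x\<in>carrier F. \<Phi> (a + b) x = \<Phi> a x + \<Phi> b x) \<and>
     (\<forall>z a. \<forall>x\<in>carrier F. \<Phi> (z *\<^sub>C a) x = z *\<^sub>C \<Phi> a x) \<and>
     (\<forall>a b. \<forall>x\<in>carrier F. \<Phi> (a * b) x = \<Phi> a (\<Phi> b x))"


section \<open>The KSGNS construction and unitary equivalence\<close>

text \<open>\<open>ksgns E \<sigma> F \<Phi> V\<close>: for \<open>\<sigma> : A \<rightarrow> \<L>\<^sub>B(E)\<close>, the triple \<open>(\<Phi>, F, V)\<close> has the properties that
  characterise \<open>(\<Phi>\<^sub>\<sigma>, E\<^sub>\<sigma>, V\<^sub>\<sigma>)\<close> up to unitary equivalence. The witness \<open>W\<close> is \<open>V\<^sup>*\<close>.\<close>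

definition ksgns ::
  "('e::complex_vector, 'b::cstar_algebra) hmod \<Rightarrow> ('a::complex_star_algebra \<Rightarrow> 'e \<Rightarrow> 'e) \<Rightarrow>
   ('f::complex_vector, 'b) hmod \<Rightarrow> ('a \<Rightarrow> 'f \<Rightarrow> 'f) \<Rightarrow> ('e \<Rightarrow> 'f) \<Rightarrow> bool" where
  "ksgns E \<sigma> F \<Phi> V \<longleftrightarrow>
     hilbert_module F \<and> representation_on F \<Phi> \<and>
     (\<exists>W. adjoint_on E F V W \<and> (\<forall>a. \<forall>x\<in>carrier E. \<sigma> a x = W (\<Phi> a (V x)))) \<and>
     (\<forall>y\<in>carrier F. \<forall>e>0.
        \<exists>y'\<in>cspan {\<Phi> a (V x) |a x. x \<in> carrier E}. hnorm F (y - y') < e)"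

definition unitarily_equivalent_repr ::
  "('e::complex_vector, 'b) hmod \<Rightarrow> ('a \<Rightarrow> 'e \<Rightarrow> 'e) \<Rightarrow>
   ('f::complex_vector, 'b) hmod \<Rightarrow> ('a \<Rightarrow> 'f \<Rightarrow> 'f) \<Rightarrow> bool" where
  "unitarily_equivalent_repr E \<Phi> F \<Psi> \<longleftrightarrow>
     (\<exists>U. unitary_on E F U \<and> (\<forall>a. \<forall>x\<in>carrier E. U (\<Phi> a x) = \<Psi> a (U x)))"

text \<open>For \<open>B\<close>-valued maps, an element of \<open>B\<close> acts on the module \<open>B\<close> by left multiplication.
  HOL cannot quantify over types within a formula, so the ambient type \<^typ>\<open>'h\<close> of the KSGNS
  modules is a parameter. In a hypothesis of a theorem with \<^typ>\<open>'h\<close> a free type variable, the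
  KSGNS modules are thus allowed to live in any type.\<close>

definition unitarily_equivalent_cp ::
  "'h::complex_vector itself \<Rightarrow> ('a::complex_star_algebra \<Rightarrow> 'b::cstar_algebra) \<Rightarrow>
    ('a \<Rightarrow> 'b) \<Rightarrow> bool" where
  "unitarily_equivalent_cp (_ :: 'h itself) \<sigma> \<tau> \<longleftrightarrow>
     (\<exists>(E :: ('h, 'b) hmod) \<Phi> V (F :: ('h, 'b) hmod) \<Psi> W.
        ksgns self_module (\<lambda>a x. \<sigma> a * x) E \<Phi> V \<and>
        ksgns self_module (\<lambda>a x. \<tau> a * x) F \<Psi> W \<and>
        unitarily_equivalent_repr E \<Phi> F \<Psi>)"


section \<open>Maps between vector spaces as a vector space\<close>

text \<open>Pointwise structure; it gives the convex structure for \<^const>\<open>extreme_point_of\<close> on sets of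
  maps.\<close>

instantiation "fun" :: (type, real_vector) real_vector
begin

definition scaleR_fun :: "real \<Rightarrow> ('a \<Rightarrow> 'b) \<Rightarrow> 'a \<Rightarrow> 'b" where
  "r *\<^sub>R f = (\<lambda>x. r *\<^sub>R f x)"

instance
  by standard (auto simp: scaleR_fun_def fun_eq_iff scaleR_add_right scaleR_add_left)

end

end

theory Submission
  imports Defs
begin

text \<open>Let \<open>\<phi> = (1 - t) \<psi>\<^sub>1 + t \<psi>\<^sub>2\<close> be a proper convex combination of unital completely positive maps
from \<open>A\<close> to \<open>M\<^sub>n(B)\<close>. On the diagonal, purity of \<open>\<rho>\<^sub>i\<^sub>i\<close> leaves no room: the entry \<open>(i, i)\<close> of
\<open>(1 - t) \<psi>\<^sub>1\<close> is dominated by \<open>\<rho>\<^sub>i\<^sub>i\<close>, hence a multiple of it, and the value at \<open>1\<close> determines the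
factor (\<open>pure_cp_convex_combination\<close>). So all diagonal entries of \<open>\<psi>\<^sub>1\<close>, \<open>\<psi>\<^sub>2\<close> and \<open>\<phi>\<close> agree.

Off the diagonal, think of a completely positive \<open>\<psi>\<close> as \<open>\<psi>\<^sub>i\<^sub>j(a) = \<langle>\<xi>\<^sub>i, a \<xi>\<^sub>j\<rangle>\<close> for vectors \<open>\<xi>\<^sub>i\<close> in a
module on which \<open>A\<close> acts. If \<open>\<psi>\<close> is unital, the \<open>\<xi>\<^sub>i\<close> are unit vectors, and for a unitary \<open>u\<close>
the square of the distance from \<open>\<xi>\<^sub>i\<close> to \<open>u \<xi>\<^sub>j\<close> is \<open>2 - \<psi>\<^sub>i\<^sub>j(u) - \<psi>\<^sub>j\<^sub>i(u\<^sup>*)\<close>. This defect is affine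
in \<open>\<psi>\<close> and positive, and for \<open>\<phi>\<close> and \<open>u = u\<^sub>i\<^sub>j\<close> it is \<open>2 - 1 - 1 = 0\<close>; therefore it vanishes for
\<open>\<psi>\<^sub>1\<close> and \<open>\<psi>\<^sub>2\<close> too. Then \<open>\<xi>\<^sub>i = u \<xi>\<^sub>j\<close>, so that \<open>\<psi>\<^sub>i\<^sub>j(b) = \<psi>\<^sub>i\<^sub>i(b u\<^sup>*) = \<rho>\<^sub>i\<^sub>i(b u\<^sup>*)\<close> for both maps
(\<open>unital_cp_coincidence\<close>), and \<open>\<psi>\<^sub>1 = \<psi>\<^sub>2\<close>. The module is never built: finitely many of its
vectors suffice, and these are read off from the positivity of one matrix \<open>[a\<^sub>k\<^sup>* a\<^sub>l]\<close>
(\<open>completely_positive_gram\<close>).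

Two facts about \<open>C\<^sup>*\<close>-algebras enter. A vanishing sum of elements \<open>b\<^sup>* b\<close> has only zero summands;
this rests on the theorem of Fukamiya and Kaplansky that \<open>b\<^sup>* b\<close> is positive in the spectral sense
(\<open>nonneg_star_mult_self\<close>). And a Gram matrix \<open>Z\<^sup>* Z\<close> with a rectangular \<open>Z\<close> is also \<open>Y\<^sup>* Y\<close> with a
square \<open>Y\<close> (\<open>positive_matrix_gram\<close>); it is needed to see that the diagonal entries of a completely
positive map are completely positive. Both are reduced to one square root construction, the
binomial series of \<open>\<surd>(1 - T)\<close>.\<close>

section \<open>The binomial series of the square root\<close>

text \<open>The coefficients of \<open>\<surd>(1 - x)\<close>. All but the first are nonpositive and they add up to \<open>0\<close>, so the
series converges absolutely even at \<open>\<bar>x\<bar> = 1\<close>; this is what makes it applicable to contractions.\<close>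

definition sqrt_coeff :: "nat \<Rightarrow> real" where
  "sqrt_coeff k = (-1) ^ k * ((1/2) gchoose k)"

lemma sqrt_coeff_0 [simp]: "sqrt_coeff 0 = 1"
  by (simp add: sqrt_coeff_def)

lemma sqrt_coeff_Suc: "sqrt_coeff (Suc k) = sqrt_coeff k * (real k - 1/2) / (real k + 1)"
proof -
  have eq: "((1/2::real) gchoose Suc k) = ((1/2) gchoose k) * (1/2 - real k) / (real k + 1)"
    using gbinomial_mult_1[of "1/2::real" k] by (simp add: field_simps)
  then show ?thesis
    unfolding sqrt_coeff_def eq by (simp add: divide_simps) (simp add: algebra_simps)
qed

lemma sqrt_coeff_Suc_nonpos: "sqrt_coeff (Suc k) \<le> 0"
proof (induction k)
  case (Suc k)
  then show ?case
    by (subst sqrt_coeff_Suc) (auto intro!: divide_nonpos_pos mult_nonpos_nonneg)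
qed (simp add: sqrt_coeff_Suc)

lemma sum_sqrt_coeff: "(\<Sum>k\<le>N. sqrt_coeff k) = - 2 * (real N + 1) * sqrt_coeff (Suc N)"
proof (induction N)
  case (Suc N)
  then show ?case
    by (simp add: sqrt_coeff_Suc[of "Suc N"]) (simp add: field_simps)
qed (simp add: sqrt_coeff_Suc)

lemma sum_abs_sqrt_coeff: "(\<Sum>k<N. \<bar>sqrt_coeff (Suc k)\<bar>) \<le> 1"
proof -
  have "0 \<le> (\<Sum>k\<le>N. sqrt_coeff k)"
    unfolding sum_sqrt_coeff using sqrt_coeff_Suc_nonpos[of N]
    by (intro mult_nonpos_nonpos) auto
  also have "\<dots> = 1 + (\<Sum>k<N. sqrt_coeff (Suc k))"
    by (metis lessThan_Suc_atMost sqrt_coeff_0 sum.lessThan_Suc_shift)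
  finally show ?thesis
    using sqrt_coeff_Suc_nonpos by (simp add: abs_of_nonpos sum_negf)
qed

lemma summable_abs_sqrt_coeff: "summable (\<lambda>k. \<bar>sqrt_coeff k\<bar>)"
proof -
  have "summable (\<lambda>k. \<bar>sqrt_coeff (Suc k)\<bar>)"
    by (rule summableI_nonneg_bounded[where x = 1]) (auto intro: sum_abs_sqrt_coeff)
  then show ?thesis by (subst (asm) summable_Suc_iff)
qed

lemma suminf_abs_sqrt_coeff: "(\<Sum>k. \<bar>sqrt_coeff (Suc k)\<bar>) \<le> 1"
  using summable_abs_sqrt_coeff
  by (intro suminf_le_const sum_abs_sqrt_coeff) (subst summable_Suc_iff)

text \<open>Squaring the series must give \<open>1 - x\<close>; on coefficients this is the Vandermonde identity for
\<open>1/2 + 1/2 = 1\<close>.\<close>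

lemma sqrt_coeff_convolution:
  "(\<Sum>i\<le>k. sqrt_coeff i * sqrt_coeff (k - i)) = (if k = 0 then 1 else if k = 1 then -1 else 0)"
proof -
  have "(\<Sum>i\<le>k. sqrt_coeff i * sqrt_coeff (k - i)) =
      (\<Sum>i\<le>k. (-1) ^ k * ((1/2 gchoose i) * (1/2 gchoose (k - i)) :: real))"
    by (rule sum.cong) (auto simp: sqrt_coeff_def power_add[symmetric])
  also have "\<dots> = (-1) ^ k * (1 gchoose k)"
    using gbinomial_Vandermonde[of "1/2::real" "1/2" k]
    by (simp add: sum_distrib_left[symmetric] atLeast0AtMost)
  also have "(1 gchoose k) = real (1 choose k)"
    by (simp add: binomial_gbinomial)
  also have "(-1) ^ k * real (1 choose k) = (if k = 0 then 1 else if k = 1 then -1 else 0)"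
    by (auto simp: binomial_eq_0)
  finally show ?thesis .
qed

section \<open>Square roots by power series\<close>

text \<open>The size \<open>m\<close> is a natural number and not a type, because complete positivity quantifies over it;
hence matrices are functions of which only the indices below \<open>m\<close> matter. The case \<open>m = 1\<close> is the
algebra itself.\<close>

primrec matrix_power ::
  "nat \<Rightarrow> (nat \<Rightarrow> nat \<Rightarrow> 'b::complex_star_algebra) \<Rightarrow> nat \<Rightarrow> nat \<Rightarrow> nat \<Rightarrow> 'b" where
  "matrix_power m T 0 i j = (if i = j then 1 else 0)"
| "matrix_power m T (Suc k) i j = (\<Sum>l<m. T i l * matrix_power m T k l j)"

lemma matrix_power_1: "j < m \<Longrightarrow> matrix_power m T (Suc 0) i j = T i j"
  by (simp add: if_distrib[where f = "\<lambda>x. _ * x"] sum.delta cong: if_cong)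

lemma matrix_power_add:
  assumes "i < m"
  shows "matrix_power m T (a + b) i j = (\<Sum>l<m. matrix_power m T a i l * matrix_power m T b l j)"
  using assms
proof (induction a arbitrary: i)
  case 0
  then show ?case
    by (simp add: if_distrib[where f = "\<lambda>x. x * _"] sum.delta cong: if_cong)
next
  case (Suc a)
  then show ?case
    by (simp add: sum_distrib_left sum_distrib_right mult.assoc) (rule sum.swap)
qed

lemma star_matrix_power:
  assumes T: "\<And>i j. i < m \<Longrightarrow> j < m \<Longrightarrow> star (T i j) = T j i"
    and "i < m" "j < m"
  shows "star (matrix_power m T k i j) = matrix_power m T k j i"
  using assms(2,3)
proof (induction k arbitrary: i j)
  case (Suc k)
  have "star (matrix_power m T (Suc k) i j) = (\<Sum>l<m. matrix_power m T k j l * T l i)"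
    using Suc by (simp add: star_sum star_mult T)
  also have "\<dots> = (\<Sum>l<m. matrix_power m T k j l * matrix_power m T (Suc 0) l i)"
    by (rule sum.cong) (use Suc in \<open>simp_all only: matrix_power_1\<close>)
  also have "\<dots> = matrix_power m T (Suc k) j i"
    using Suc.prems matrix_power_add[of j m T k "Suc 0" i] by simp
  finally show ?case .
qed auto

lemma summable_sqrt_series:
  fixes p :: "nat \<Rightarrow> 'b::cstar_algebra"
  assumes "\<And>k. norm (p k) \<le> C"
  shows "summable (\<lambda>k. norm (sqrt_coeff k *\<^sub>R p k))"
proof (rule summable_comparison_test')
  show "summable (\<lambda>k. \<bar>sqrt_coeff k\<bar> * C)"
    using summable_abs_sqrt_coeff by (rule summable_mult2)
  show "norm (norm (sqrt_coeff k *\<^sub>R p k)) \<le> \<bar>sqrt_coeff k\<bar> * C" for k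
    using assms by (simp add: mult_left_mono)
qed

text \<open>Bounded entries of the powers of \<open>T\<close> suffice for the binomial series to converge entrywise, so no
norm on the matrix algebra is needed. The Cauchy product of absolutely convergent series in \<open>B\<close>
squares the series.\<close>

lemma matrix_sqrt_one_minus:
  fixes T :: "nat \<Rightarrow> nat \<Rightarrow> 'b::cstar_algebra"
  assumes bound: "\<And>k i j. i < m \<Longrightarrow> j < m \<Longrightarrow> norm (matrix_power m T k i j) \<le> C"
    and "i < m" "j < m"
  defines "S \<equiv> \<lambda>i j. \<Sum>k. sqrt_coeff k *\<^sub>R matrix_power m T k i j"
  shows "(\<Sum>l<m. S i l * S l j) = (if i = j then 1 else 0) - T i j"
proof -
  let ?P = "matrix_power m T"
  have summ: "summable (\<lambda>k. norm (sqrt_coeff k *\<^sub>R ?P k i j))" if "i < m" "j < m" for i j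
    by (rule summable_sqrt_series) (rule bound[OF that])
  have "(\<lambda>k. \<Sum>l<m. \<Sum>a\<le>k. (sqrt_coeff a *\<^sub>R ?P a i l) * (sqrt_coeff (k - a) *\<^sub>R ?P (k - a) l j))
      sums (\<Sum>l<m. S i l * S l j)"
    unfolding S_def using assms(2,3) by (intro sums_sum Cauchy_product_sums summ) auto
  moreover have "(\<Sum>l<m. \<Sum>a\<le>k. (sqrt_coeff a *\<^sub>R ?P a i l) * (sqrt_coeff (k - a) *\<^sub>R ?P (k - a) l j))
      = (if k = 0 then ?P 0 i j else if k = 1 then - ?P 1 i j else 0)" for k
  proof -
    have "(\<Sum>l<m. \<Sum>a\<le>k. (sqrt_coeff a *\<^sub>R ?P a i l) * (sqrt_coeff (k - a) *\<^sub>R ?P (k - a) l j))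
        = (\<Sum>a\<le>k. \<Sum>l<m. (sqrt_coeff a * sqrt_coeff (k - a)) *\<^sub>R (?P a i l * ?P (k - a) l j))"
      by (subst sum.swap) (simp add: mult.commute)
    also have "\<dots> = (\<Sum>a\<le>k. (sqrt_coeff a * sqrt_coeff (k - a)) *\<^sub>R ?P k i j)"
      unfolding scaleR_sum_right[symmetric] using assms(2)
      by (intro sum.cong) (simp_all add: matrix_power_add[symmetric] del: matrix_power.simps)
    also have "\<dots> = (\<Sum>a\<le>k. sqrt_coeff a * sqrt_coeff (k - a)) *\<^sub>R ?P k i j"
      by (simp add: scaleR_sum_left)
    finally show ?thesis
      by (auto simp: sqrt_coeff_convolution simp del: matrix_power.simps)
  qed
  ultimately have "(\<lambda>k. if k = 0 then ?P 0 i j else if k = 1 then - ?P 1 i j else 0)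
      sums (\<Sum>l<m. S i l * S l j)"
    by (simp del: matrix_power.simps)
  moreover have "(\<lambda>k. if k = 0 then ?P 0 i j else if k = 1 then - ?P 1 i j else 0)
      sums (\<Sum>k\<in>{0, 1::nat}. if k = 0 then ?P 0 i j else if k = 1 then - ?P 1 i j else 0)"
    by (rule sums_finite) auto
  ultimately have "(\<Sum>l<m. S i l * S l j) = ?P 0 i j - ?P (Suc 0) i j"
    by (simp add: sums_unique2 del: matrix_power.simps)
  then show ?thesis
    using assms(3) by (simp only: matrix_power_1 matrix_power.simps(1))
qed

lemma star_scaleR: "star (r *\<^sub>R x) = r *\<^sub>R star (x :: 'a::complex_star_algebra)"
  by (simp add: scaleR_scaleC star_scaleC)

lemma star_minus: "star (- x) = - star (x :: 'a::complex_star_algebra)"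
  using star_scaleR[of "-1" x] by simp

lemma star_diff: "star (x - y) = star x - star (y :: 'a::complex_star_algebra)"
  using star_add[of x "- y"] by (simp add: star_minus)

lemma norm_one_le: "norm (1 :: 'b::cstar_algebra) \<le> 1"
  using norm_star_mult_self[of "1 :: 'b"] by (auto simp: power2_eq_square)

lemma norm_power_le_one: "norm (x :: 'b::cstar_algebra) \<le> 1 \<Longrightarrow> norm (x ^ k) \<le> 1"
proof (induction k)
  case (Suc k)
  have "norm (x * x ^ k) \<le> norm x * norm (x ^ k)"
    by (rule norm_mult_ineq)
  also have "\<dots> \<le> 1"
    using Suc by (simp add: mult_le_one)
  finally show ?case by simp
qed (simp add: norm_one_le)

text \<open>The bound on \<open>1 - s\<close> shows that the root is again positive, and the commutation property allows
roots of several commuting elements to be combined.\<close>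

lemma sqrt_one_minus:
  fixes T :: "'b::cstar_algebra"
  assumes "star T = T" "norm T \<le> 1"
  obtains s where "star s = s" "s * s = 1 - T" "norm (1 - s) \<le> 1"
    "\<And>x. x * T = T * x \<Longrightarrow> x * s = s * x"
proof
  define s where "s = (\<Sum>k. sqrt_coeff k *\<^sub>R T ^ k)"
  have summ: "summable (\<lambda>k. norm (sqrt_coeff k *\<^sub>R T ^ k))"
    using norm_power_le_one[OF assms(2)] by (rule summable_sqrt_series)
  note summ' = summable_norm_cancel[OF summ]
  have P: "matrix_power 1 (\<lambda>_ _. T) k 0 0 = T ^ k" for k
    by (induction k) auto
  show "s * s = 1 - T"
    using matrix_sqrt_one_minus[of 1 "\<lambda>_ _. T" 1 0 0] norm_power_le_one[OF assms(2)]
    by (simp add: P[simplified] s_def)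
  have "star (T ^ k) = T ^ k" for k
    by (induction k) (simp_all add: star_mult assms power_commutes)
  then show "star s = s"
    unfolding s_def by (subst bounded_linear.suminf[OF bounded_linear_star summ']) (simp add: star_scaleR)
  show "x * s = s * x" if "x * T = T * x" for x
  proof -
    have "x * T ^ k = T ^ k * x" for k
      using power_commuting_commutes[of T x k] that by simp
    then show ?thesis
      unfolding s_def using summ' by (simp add: suminf_mult[symmetric] suminf_mult2)
  qed
  have "s = 1 + (\<Sum>k. sqrt_coeff (Suc k) *\<^sub>R T ^ Suc k)"
    unfolding s_def using suminf_split_head[OF summ'] by (simp add: algebra_simps)
  then have "norm (1 - s) = norm (\<Sum>k. sqrt_coeff (Suc k) *\<^sub>R T ^ Suc k)"
    by simp
  also have "\<dots> \<le> (\<Sum>k. \<bar>sqrt_coeff (Suc k)\<bar>)"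
  proof (rule norm_suminf_le)
    show "norm (sqrt_coeff (Suc k) *\<^sub>R T ^ Suc k) \<le> \<bar>sqrt_coeff (Suc k)\<bar>" for k
      using norm_power_le_one[OF assms(2), of "Suc k"] by (simp add: mult_left_le)
    show "summable (\<lambda>k. \<bar>sqrt_coeff (Suc k)\<bar>)"
      using summable_abs_sqrt_coeff by (subst summable_Suc_iff)
  qed
  also have "\<dots> \<le> 1"
    by (rule suminf_abs_sqrt_coeff)
  finally show "norm (1 - s) \<le> 1" .
qed

section \<open>Positivity by norms\<close>

text \<open>For a self-adjoint element, \<open>\<parallel>t 1 - h\<parallel> \<le> t\<close> says that the spectrum of \<open>h\<close> lies in \<open>[0, 2t]\<close>. This
form of positivity is visibly a convex cone, whereas for \<open>h = b\<^sup>* b\<close> closure under sums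
is not apparent.\<close>

definition nonneg :: "'b::cstar_algebra \<Rightarrow> bool" where
  "nonneg h \<longleftrightarrow> star h = h \<and> (\<exists>t\<ge>0. norm (t *\<^sub>R 1 - h) \<le> t)"

lemma nonnegI: "star h = h \<Longrightarrow> 0 \<le> t \<Longrightarrow> norm (t *\<^sub>R 1 - h) \<le> t \<Longrightarrow> nonneg h"
  by (auto simp: nonneg_def)

lemma nonneg_star: "nonneg h \<Longrightarrow> star h = h"
  by (simp add: nonneg_def)

lemma nonneg_0 [simp]: "nonneg 0"
  by (rule nonnegI[where t = 0]) auto

lemma nonneg_add:
  assumes "nonneg h" "nonneg k"
  shows "nonneg (h + k)"
proof -
  obtain s t where "0 \<le> s" "norm (s *\<^sub>R 1 - h) \<le> s" "0 \<le> t" "norm (t *\<^sub>R 1 - k) \<le> t"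
    using assms by (auto simp: nonneg_def)
  moreover have "norm ((s + t) *\<^sub>R 1 - (h + k)) \<le> norm (s *\<^sub>R 1 - h) + norm (t *\<^sub>R 1 - k)"
    using norm_triangle_ineq[of "s *\<^sub>R 1 - h" "t *\<^sub>R 1 - k"] by (simp add: algebra_simps)
  ultimately show ?thesis
    using assms by (intro nonnegI[where t = "s + t"]) (auto simp: nonneg_star star_add)
qed

lemma nonneg_sum: "(\<And>i. i \<in> S \<Longrightarrow> nonneg (f i)) \<Longrightarrow> nonneg (\<Sum>i\<in>S. f i)"
  by (induction S rule: infinite_finite_induct) (auto intro: nonneg_add)

lemma nonneg_scaleR:
  assumes "nonneg h" "0 \<le> r"
  shows "nonneg (r *\<^sub>R h)"
proof -
  obtain t where t: "0 \<le> t" "norm (t *\<^sub>R 1 - h) \<le> t"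
    using assms by (auto simp: nonneg_def)
  have "norm ((r * t) *\<^sub>R 1 - r *\<^sub>R h) = r * norm (t *\<^sub>R 1 - h)"
    using assms(2) by (simp flip: scaleR_scaleR scaleR_diff_right)
  also have "\<dots> \<le> r * t"
    using t(2) assms(2) by (rule mult_left_mono)
  finally show ?thesis
    using assms t(1) by (intro nonnegI[where t = "r * t"]) (simp_all add: nonneg_star star_scaleR)
qed

lemma nonneg_bound:
  fixes h :: "'b::cstar_algebra"
  assumes "nonneg h"
  obtains r where "r > 0" "norm (r *\<^sub>R 1 - h) \<le> r"
proof -
  obtain t where t: "0 \<le> t" "norm (t *\<^sub>R 1 - h) \<le> t"
    using assms by (auto simp: nonneg_def)
  have "norm ((t + 1) *\<^sub>R 1 - h) \<le> norm (t *\<^sub>R 1 - h) + norm (1 :: 'b)"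
    using norm_triangle_ineq[of "t *\<^sub>R 1 - h" 1] by (simp add: algebra_simps)
  also have "\<dots> \<le> t + 1"
    using t norm_one_le[where 'b = 'b] by simp
  finally show ?thesis
    using t by (intro that[of "t + 1"]) simp_all
qed

lemma nonneg_sqrt:
  fixes h :: "'b::cstar_algebra"
  assumes "nonneg h"
  obtains k where "nonneg k" "k * k = h" "\<And>x. x * h = h * x \<Longrightarrow> x * k = k * x"
proof -
  have h: "star h = h"
    using assms by (rule nonneg_star)
  obtain r where r: "r > 0" and "norm (r *\<^sub>R 1 - h) \<le> r"
    using assms by (rule nonneg_bound)
  moreover have eq: "1 - (1/r) *\<^sub>R h = (1/r) *\<^sub>R (r *\<^sub>R 1 - h)"
    using r by (simp add: scaleR_diff_right)
  ultimately have contr: "norm (1 - (1/r) *\<^sub>R h) \<le> 1"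
    using r by (simp add: eq)
  have self_adj: "star (1 - (1/r) *\<^sub>R h) = 1 - (1/r) *\<^sub>R h"
    by (simp only: star_diff star_scaleR star_one h)
  obtain s where s: "star s = s" "s * s = 1 - (1 - (1/r) *\<^sub>R h)" "norm (1 - s) \<le> 1"
      and comm: "\<And>x. x * (1 - (1/r) *\<^sub>R h) = (1 - (1/r) *\<^sub>R h) * x \<Longrightarrow> x * s = s * x"
    by (rule sqrt_one_minus[OF self_adj contr]) (rule that; assumption)
  show ?thesis
  proof
    have "nonneg s"
      using s by (intro nonnegI[where t = 1]) simp_all
    then show "nonneg (sqrt r *\<^sub>R s)"
      using r by (intro nonneg_scaleR) simp_all
    show "(sqrt r *\<^sub>R s) * (sqrt r *\<^sub>R s) = h"
      using s(2) r by simp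
    show "x * (sqrt r *\<^sub>R s) = (sqrt r *\<^sub>R s) * x" if "x * h = h * x" for x
    proof -
      have "x * s = s * x"
        by (rule comm) (simp add: left_diff_distrib right_diff_distrib that)
      then show ?thesis by simp
    qed
  qed
qed

text \<open>The element \<open>w = k + \<i> s\<close> satisfies \<open>w\<^sup>* w = k\<^sup>2 + s\<^sup>2 = 1\<close>, hence has norm at most \<open>1\<close>, and so have its
real and imaginary parts.\<close>

lemma norm_le_one_of_sum_squares:
  fixes k s :: "'b::cstar_algebra"
  assumes "star k = k" "star s = s" "k * s = s * k" "k * k + s * s = 1"
  shows "norm k \<le> 1" "norm s \<le> 1"
proof -
  have *: "norm x \<le> 1" if "star x = x" "star y = y" "x * y = y * x" "x * x + y * y = 1" for x y :: 'b
  proof -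
    define w where "w = x + \<i> *\<^sub>C y"
    have "star w * w = x * x + y * y" 
      using that
      by (simp add: w_def star_add star_scaleC algebra_simps scaleC_mult_left scaleC_mult_right
          scaleC_scaleC)
    then have "(norm w)\<^sup>2 \<le> 1"
      using norm_star_mult_self[of w] that norm_one_le[where 'b = 'b] by simp
    then have w: "norm w \<le> 1"
      by (simp add: power_le_one_iff)
    have "2 *\<^sub>R x = w + star w"
      using that by (simp add: w_def star_add star_scaleC scaleR_2)
    then have "2 * norm x \<le> norm w + norm (star w)"
      using norm_triangle_ineq[of w "star w"] by (metis abs_numeral norm_scaleR)
    then show ?thesis using w by simp
  qed
  show "norm k \<le> 1" using *[of k s] assms by simp
  show "norm s \<le> 1" using *[of s k] assms by (simp add: add.commute)
qed

lemma norm_square: "star k = k \<Longrightarrow> norm (k * k) = (norm (k :: 'b::cstar_algebra))\<^sup>2"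
  using norm_star_mult_self[of k] by simp

text \<open>After scaling, \<open>\<parallel>k\<parallel> \<le> 1\<close>. Then \<open>1 - k\<^sup>2\<close> has a root \<open>s\<close> which commutes with \<open>k\<close>, so that
\<open>\<parallel>s\<parallel> \<le> 1\<close> and \<open>\<parallel>1 - k\<^sup>2\<parallel> = \<parallel>s\<parallel>\<^sup>2 \<le> 1\<close>.\<close>

lemma nonneg_square:
  fixes k :: "'b::cstar_algebra"
  assumes "star k = k"
  shows "nonneg (k * k)"
proof -
  define r where "r = norm k + 1"
  define x where "x = (1/r) *\<^sub>R k"
  have r: "r > 0" "norm k \<le> r"
    by (simp_all add: r_def add_nonneg_pos)
  have x: "star x = x" "norm x \<le> 1"
    using r assms by (simp_all add: x_def star_scaleR)
  then have "norm (x * x) \<le> 1"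
    by (simp add: norm_square power_le_one)
  then obtain s where s: "star s = s" "s * s = 1 - x * x"
      "\<And>y. y * (x * x) = (x * x) * y \<Longrightarrow> y * s = s * y"
    using sqrt_one_minus[of "x * x"] x by (metis star_mult)
  have "norm s \<le> 1"
    using x s by (intro norm_le_one_of_sum_squares(2)[of x s]) (simp_all add: mult.assoc)
  then have "norm (1 - x * x) \<le> 1"
    using s by (metis norm_square norm_ge_zero power_le_one)
  then have "nonneg (x * x)"
    using x by (intro nonnegI[where t = 1]) (simp_all add: star_mult)
  then have "nonneg ((r * r) *\<^sub>R (x * x))"
    using r by (intro nonneg_scaleR) auto
  then show ?thesis
    using r by (simp add: x_def)
qed

lemma norm_le_one_of_nonneg:
  fixes a :: "'b::cstar_algebra"
  assumes "nonneg a" "nonneg (1 - a)"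
  shows "norm a \<le> 1"
proof -
  obtain k where k: "nonneg k" "k * k = a" "\<And>x. x * a = a * x \<Longrightarrow> x * k = k * x"
    using nonneg_sqrt[OF assms(1)] by blast
  obtain s where s: "nonneg s" "s * s = 1 - a"
      "\<And>x. x * (1 - a) = (1 - a) * x \<Longrightarrow> x * s = s * x"
    using nonneg_sqrt[OF assms(2)] by blast
  have "k * (1 - a) = (1 - a) * k"
    using k(2) by (simp add: algebra_simps flip: k(2))
  then have "k * s = s * k"
    by (rule s(3))
  moreover have "k * k + s * s = 1"
    unfolding k(2) s(2) by simp
  ultimately have "norm k \<le> 1"
    using k(1) s(1) by (intro norm_le_one_of_sum_squares(1)[of k s] nonneg_star)
  moreover have "norm a = (norm k)\<^sup>2"
    using norm_square[OF nonneg_star[OF k(1)]] unfolding k(2) .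
  ultimately show ?thesis
    by (simp add: power_le_one)
qed

text \<open>With \<open>r\<close> slightly larger than \<open>\<parallel>a + b\<parallel>\<close> the element \<open>r - (a + b)\<close> is positive, hence so is
\<open>r - a\<close>, which bounds the norm of \<open>a\<close> by \<open>r\<close>.\<close>

lemma norm_mono:
  fixes a b :: "'b::cstar_algebra"
  assumes "nonneg a" "nonneg b"
  shows "norm a \<le> norm (a + b)"
proof (rule field_le_epsilon)
  fix e :: real
  assume e: "e > 0"
  define r where "r = norm (a + b) + e"
  have r: "r > 0" using e by (simp add: r_def add_nonneg_pos)
  define c where "c = (1/r) *\<^sub>R (a + b)"
  have "nonneg c"
    unfolding c_def using assms r by (intro nonneg_scaleR nonneg_add) auto
  moreover have "norm c \<le> 1"
    using r e by (simp add: c_def r_def)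
  ultimately have "nonneg (1 - c)"
    by (intro nonnegI[where t = 1]) (auto simp: star_diff nonneg_star)
  then have "nonneg ((1 - c) + (1/r) *\<^sub>R b)"
    using assms r by (intro nonneg_add nonneg_scaleR) auto
  then have "nonneg (1 - (1/r) *\<^sub>R a)"
    by (simp add: c_def algebra_simps)
  then have "norm ((1/r) *\<^sub>R a) \<le> 1"
    using assms r by (intro norm_le_one_of_nonneg nonneg_scaleR) auto
  then show "norm a \<le> norm (a + b) + e"
    using r by (simp add: r_def)
qed

lemma nonneg_antisym: "nonneg a \<Longrightarrow> nonneg (- a) \<Longrightarrow> a = 0"
  using norm_mono[of a "- a"] by simp

section \<open>Positivity of \<open>b\<^sup>* b\<close>\<close>

text \<open>The powers of \<open>1 - c\<^sup>* c\<close> are expressed through those of \<open>1 - c c\<^sup>*\<close>: the factor \<open>A\<close> is the geometric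
sum of the first \<open>n\<close> powers of \<open>1 - c c\<^sup>*\<close>. It is an elementary substitute for the fact that
\<open>c\<^sup>* c\<close> and \<open>c c\<^sup>*\<close> have the same nonzero spectrum.\<close>

lemma power_one_minus_star_mult:
  fixes c :: "'b::cstar_algebra"
  assumes "norm (1 - c * star c) \<le> 1"
  shows "\<exists>A. norm A \<le> real n \<and> (1 - star c * c) ^ n = 1 - star c * A * c"
proof (induction n)
  case 0
  show ?case by (rule exI[of _ 0]) simp
next
  case (Suc n)
  then obtain A where A: "norm A \<le> real n" "(1 - star c * c) ^ n = 1 - star c * A * c"
    by blast
  let ?B = "1 + (1 - c * star c) * A"
  have "norm ((1 - c * star c) * A) \<le> norm (1 - c * star c) * norm A"
    by (rule norm_mult_ineq)
  also have "\<dots> \<le> 1 * real n"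
    using assms A(1) by (intro mult_mono) auto
  finally have "norm ?B \<le> 1 + real n"
    using norm_triangle_ineq[of 1 "(1 - c * star c) * A"] norm_one_le[where 'b = 'b] by linarith
  moreover have "(1 - star c * c) ^ Suc n = 1 - star c * ?B * c"
    unfolding power_Suc A(2) by (simp add: algebra_simps mult.assoc)
  ultimately show ?case
    by (intro exI[of _ ?B]) simp
qed

lemma norm_power_two_power:
  assumes "star y = y"
  shows "norm ((y :: 'b::cstar_algebra) ^ (2 ^ k)) = norm y ^ (2 ^ k)"
proof (induction k)
  case (Suc k)
  have "star (y ^ n) = y ^ n" for n
    by (induction n) (simp_all add: star_mult assms power_commutes)
  then have "norm (y ^ 2 ^ k * y ^ 2 ^ k) = (norm (y ^ 2 ^ k))\<^sup>2"
    by (rule norm_square)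
  then show ?case
    using Suc by (simp add: power_add[symmetric] mult_2 power_mult[symmetric] mult.commute)
qed simp

text \<open>Exponential growth against a linear bound. The bound is only assumed for exponents that are powers
of two, where the \<open>C\<^sup>*\<close>-identity directly gives \<open>\<parallel>y\<^sup>k\<parallel> = \<parallel>y\<parallel>\<^sup>k\<close> for self-adjoint \<open>y\<close>.\<close>

lemma le_one_of_powers_linear_bound:
  fixes q M :: real
  assumes "0 \<le> M" "\<And>k. q ^ (2 ^ k) \<le> 1 + 2 ^ k * M"
  shows "q \<le> 1"
proof (rule ccontr)
  assume "\<not> q \<le> 1"
  then have d: "q - 1 > 0" by simp
  define d where "d = q - 1"
  note d = d[folded d_def]
  obtain n :: nat where n: "2 * M / d\<^sup>2 < n"
    using reals_Archimedean2 by blast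
  \<comment> \<open>Bernoulli at \<open>2\<^sup>n\<close> is squared, so that its quadratic term beats the bound at \<open>2\<^sup>n\<^sup>+\<^sup>1\<close>.\<close>
  define N :: real where "N = 2 ^ n"
  have N: "N > 0" "real n < N"
    unfolding N_def using of_nat_less_two_power[of n, where 'a = real] by auto
  have "1 + N * d \<le> q ^ (2 ^ n)"
    using Bernoulli_inequality[of d "2 ^ n"] d by (simp add: N_def d_def)
  then have "(1 + N * d)\<^sup>2 \<le> (q ^ (2 ^ n))\<^sup>2"
    using N d by (intro power_mono) auto
  also have "\<dots> = q ^ (2 ^ Suc n)"
    by (simp add: power_mult[symmetric] mult.commute)
  also have "\<dots> \<le> 1 + 2 * N * M"
    using assms(2)[of "Suc n"] by (simp add: N_def)
  finally have "1 + 2 * N * d + N\<^sup>2 * d\<^sup>2 \<le> 1 + 2 * N * M"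
    by (simp add: power2_eq_square algebra_simps)
  then have "N * (N * d\<^sup>2) \<le> N * (2 * M)"
    using mult_pos_pos[OF N(1) d] by (simp add: power2_eq_square algebra_simps)
  then have "N * d\<^sup>2 \<le> 2 * M"
    using N(1) by simp
  moreover have "2 * M < N * d\<^sup>2"
    using n N(2) d by (simp add: pos_divide_less_eq) (smt (verit) mult_strict_right_mono zero_less_power)
  ultimately show False by simp
qed

text \<open>Put \<open>p = - c\<^sup>* c\<close> and scale such that \<open>\<parallel>1 - c c\<^sup>*\<parallel> \<le> 1\<close>. The powers of \<open>1 + p\<close> then grow at most
linearly, so \<open>\<parallel>1 + p\<parallel> \<le> 1\<close>, which makes \<open>- p\<close> positive as well as \<open>p\<close>.\<close>

lemma eq_zero_of_star_mult_nonpos: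
  fixes c :: "'b::cstar_algebra"
  assumes "nonneg (- (star c * c))" "nonneg (c * star c)"
  shows "c = 0"
proof -
  have key: "x = 0" if neg: "nonneg (- (star x * x))" and contr: "norm (1 - x * star x) \<le> 1" for x :: 'b
  proof -
    define p where "p = - (star x * x)"
    have p: "nonneg p" using neg by (simp add: p_def)
    have y: "star (1 + p) = 1 + p"
      using nonneg_star[OF p] by (simp add: star_add)
    have "norm (1 + p) ^ (2 ^ k) \<le> 1 + 2 ^ k * (norm x * norm x)" for k
    proof -
      obtain A where A: "norm A \<le> real (2 ^ k)" "(1 + p) ^ (2 ^ k) = 1 - star x * A * x"
        using power_one_minus_star_mult[OF contr, of "2 ^ k"] by (auto simp: p_def)
      have "norm (star x * A * x) \<le> norm (star x) * norm A * norm x"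
        by (meson mult_right_mono norm_ge_zero norm_mult_ineq order_trans)
      also have "\<dots> \<le> norm x * 2 ^ k * norm x"
        using A(1) by (intro mult_mono) auto
      finally have "norm ((1 + p) ^ (2 ^ k)) \<le> 1 + 2 ^ k * (norm x * norm x)"
        unfolding A(2) using norm_triangle_ineq4[of 1 "star x * A * x"] norm_one_le[where 'b = 'b]
        by (simp add: algebra_simps)
      then show ?thesis
        by (simp add: norm_power_two_power[OF y])
    qed
    then have "norm (1 + p) \<le> 1"
      by (rule le_one_of_powers_linear_bound[rotated]) simp
    then have "nonneg (- p)"
      using nonneg_star[OF p] by (intro nonnegI[where t = 1]) (simp_all add: star_minus)
    then have "p = 0"
      using p by (rule nonneg_antisym[rotated])
    then show "x = 0"
      using norm_star_mult_self[of x] by (simp add: p_def)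
  qed
  obtain r where r: "r > 0" "norm (r *\<^sub>R 1 - c * star c) \<le> r"
    using assms(2) by (rule nonneg_bound)
  define x where "x = (1 / sqrt r) *\<^sub>R c"
  have xx: "star x * x = (1/r) *\<^sub>R (star c * c)" "x * star x = (1/r) *\<^sub>R (c * star c)"
    using r by (simp_all add: x_def star_scaleR)
  have "norm ((1/r) *\<^sub>R (r *\<^sub>R 1 - c * star c)) \<le> 1"
    using r by simp
  moreover have "1 - x * star x = (1/r) *\<^sub>R (r *\<^sub>R 1 - c * star c)"
    using r by (simp add: xx scaleR_diff_right)
  ultimately have "norm (1 - x * star x) \<le> 1"
    by simp
  moreover have "nonneg (- (star x * x))"
    using nonneg_scaleR[OF assms(1), of "1/r"] r by (simp add: xx)
  ultimately have "x = 0"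
    by (intro key)
  then show ?thesis
    using r by (simp add: x_def)
qed

text \<open>The theorem of Fukamiya and Kaplansky. Let \<open>h = b\<^sup>* b\<close>, \<open>g = \<bar>h\<bar>\<close>, and let \<open>r = g - h\<close> be twice the
negative part of \<open>h\<close>. For \<open>c = b r\<close> one finds \<open>c\<^sup>* c = r h r = - r\<^sup>2 g\<close>, which is negative, and since
\<open>c\<^sup>* c + c c\<^sup>*\<close> is half a sum of two squares of self-adjoint elements, \<open>c c\<^sup>*\<close> is positive. This
forces \<open>c = 0\<close>, hence \<open>r = 0\<close>, and \<open>h = g\<close> is positive.\<close>

lemma nonneg_star_mult_self:
  fixes b :: "'b::cstar_algebra"
  shows "nonneg (star b * b)"
proof -
  define h where "h = star b * b"
  have h: "star h = h" by (simp add: h_def star_mult star_star)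
  obtain g where g: "nonneg g" "g * g = h * h" "\<And>x. x * (h * h) = (h * h) * x \<Longrightarrow> x * g = g * x"
    using nonneg_sqrt[OF nonneg_square[OF h]] by blast
  obtain s where s: "nonneg s" "s * s = g" "\<And>x. x * g = g * x \<Longrightarrow> x * s = s * x"
    using nonneg_sqrt[OF g(1)] by blast
  have hg: "h * g = g * h"
    by (rule g(3)) (simp add: mult.assoc)
  define r where "r = g - h"
  have r: "star r = r"
    using h nonneg_star[OF g(1)] by (simp add: r_def star_diff)
  have rs: "r * s = s * r"
    by (rule s(3)) (simp add: r_def left_diff_distrib right_diff_distrib hg)
  define q where "q = r * s"
  have q: "star q = q"
    using r nonneg_star[OF s(1)] rs by (simp add: q_def star_mult)
  define c where "c = b * r"
  have "star c * c = r * h * r"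
    by (simp add: c_def h_def star_mult r mult.assoc)
  also have "h * r = - (r * g)"
    by (simp add: r_def left_diff_distrib right_diff_distrib hg g(2))
  then have "r * h * r = - (r * r * g)"
    by (simp add: mult.assoc)
  also have "r * r * g = q * q"
  proof -
    have "r * r * g = r * (r * s) * s"
      by (simp add: s(2)[symmetric] mult.assoc)
    also have "\<dots> = r * (s * r) * s"
      by (simp only: rs)
    finally show ?thesis
      by (simp add: q_def mult.assoc)
  qed
  finally have cc: "star c * c = - (q * q)" .
  have "nonneg (c * star c)"
  proof -
    \<comment> \<open>Twice the real part and, up to sign, twice the imaginary part of \<open>c\<close>.\<close>
    define x where "x = c + star c"
    define y where "y = \<i> *\<^sub>C (c - star c)"
    have "nonneg (x * x)" "nonneg (y * y)"
      by (rule nonneg_square; simp add: x_def y_def star_add star_diff star_scaleC star_star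
          complex_vector.scale_right_diff_distrib)+
    moreover have "c * star c = (1/2) *\<^sub>R (x * x + y * y) + q * q"
    proof -
      have "y * y = - ((c - star c) * (c - star c))"
        by (simp add: y_def scaleC_mult_left scaleC_mult_right scaleC_scaleC)
      then have "x * x + y * y = 2 *\<^sub>R (c * star c) + 2 *\<^sub>R (star c * c)"
        by (simp add: x_def algebra_simps scaleR_2)
      then show ?thesis
        by (simp add: cc scaleR_diff_right)
    qed
    ultimately show ?thesis
      using nonneg_square[OF q] by (simp add: nonneg_add nonneg_scaleR)
  qed
  moreover have "nonneg (- (star c * c))"
    using nonneg_square[OF q] by (simp add: cc)
  ultimately have "c = 0"
    by (intro eq_zero_of_star_mult_nonpos)
  then have "q * q = 0"
    using cc by simp
  then have "q = 0"
    using norm_square[OF q] by simp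
  have "r * r = 2 *\<^sub>R (g * r)"
    by (simp add: r_def algebra_simps hg g(2) scaleR_2)
  also have "g * r = s * q"
    by (simp add: q_def rs s(2)[symmetric] mult.assoc)
  finally have "r * r = 0"
    using \<open>q = 0\<close> by simp
  then have "r = 0"
    using norm_square[OF r] by simp
  then show ?thesis
    using g(1) by (simp add: r_def h_def)
qed

lemma sum_star_mult_eq_0D:
  fixes z :: "'i \<Rightarrow> 'b::cstar_algebra"
  assumes "finite S" "(\<Sum>i\<in>S. star (z i) * z i) = 0" "i \<in> S"
  shows "z i = 0"
proof -
  have "norm (star (z i) * z i) \<le> norm (star (z i) * z i + (\<Sum>j\<in>S - {i}. star (z j) * z j))"
    by (intro norm_mono nonneg_sum nonneg_star_mult_self)
  also have "\<dots> = 0"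
    using sum.remove[OF assms(1,3), of "\<lambda>i. star (z i) * z i"] assms(2) by simp
  finally show ?thesis
    by (simp add: norm_star_mult_self)
qed

section \<open>Gram matrices\<close>

definition column_inner :: "nat \<Rightarrow> (nat \<Rightarrow> 'b::cstar_algebra) \<Rightarrow> (nat \<Rightarrow> 'b) \<Rightarrow> 'b" where
  "column_inner m x y = (\<Sum>i<m. star (x i) * y i)"

definition matrix_apply :: "nat \<Rightarrow> (nat \<Rightarrow> nat \<Rightarrow> 'b::cstar_algebra) \<Rightarrow> (nat \<Rightarrow> 'b) \<Rightarrow> nat \<Rightarrow> 'b" where
  "matrix_apply m T x i = (\<Sum>j<m. T i j * x j)"

lemma column_inner_diff_right:
  "column_inner m x (\<lambda>i. y i - z i) = column_inner m x y - column_inner m x z"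
  by (simp add: column_inner_def right_diff_distrib sum_subtractf)

lemma column_inner_diff_left:
  "column_inner m (\<lambda>i. x i - y i) z = column_inner m x z - column_inner m y z"
  by (simp add: column_inner_def star_diff left_diff_distrib sum_subtractf)

lemma matrix_apply_diff:
  "matrix_apply m T (\<lambda>i. x i - y i) = (\<lambda>i. matrix_apply m T x i - matrix_apply m T y i)"
  by (rule ext) (simp add: matrix_apply_def right_diff_distrib sum_subtractf)

lemma column_inner_matrix_apply:
  assumes "\<And>i j. i < m \<Longrightarrow> j < m \<Longrightarrow> star (T i j) = T j i"
  shows "column_inner m (matrix_apply m T x) y = column_inner m x (matrix_apply m T y)"
proof -
  have "column_inner m (matrix_apply m T x) y = (\<Sum>i<m. \<Sum>j<m. star (x j) * T j i * y i)"
    by (simp add: column_inner_def matrix_apply_def star_sum star_mult sum_distrib_right assms)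
  also have "\<dots> = (\<Sum>j<m. \<Sum>i<m. star (x j) * T j i * y i)"
    by (rule sum.swap)
  also have "\<dots> = column_inner m x (matrix_apply m T y)"
    by (simp add: column_inner_def matrix_apply_def sum_distrib_left mult.assoc)
  finally show ?thesis .
qed

text \<open>If \<open>0 \<le> T \<le> 1\<close> as a form, then \<open>T\<^sup>2 \<le> 1\<close>, because \<open>1 - T\<^sup>2 = (1 - T) + T (1 - T)\<close> and
\<open>T (1 - T) = T (1 - T) T + (1 - T) T (1 - T)\<close>.\<close>

lemma positive_contraction_shrinks:
  assumes T: "\<And>i j. i < m \<Longrightarrow> j < m \<Longrightarrow> star (T i j) = T j i"
    and pos: "\<And>x. nonneg (column_inner m x (matrix_apply m T x))"
    and contr: "\<And>x. nonneg (column_inner m x x - column_inner m x (matrix_apply m T x))"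
  shows "nonneg (column_inner m x x - column_inner m (matrix_apply m T x) (matrix_apply m T x))"
proof -
  define Tx where "Tx = matrix_apply m T x"
  define TTx where "TTx = matrix_apply m T Tx"
  define y where "y = (\<lambda>i. x i - Tx i)"
  have Ty: "matrix_apply m T y = (\<lambda>i. Tx i - TTx i)"
    by (simp add: y_def matrix_apply_diff Tx_def TTx_def)
  have "column_inner m x TTx = column_inner m Tx Tx"
    using column_inner_matrix_apply[of m T x Tx] T by (simp add: TTx_def Tx_def)
  then have eq: "column_inner m x x - column_inner m Tx Tx =
      (column_inner m x x - column_inner m x Tx) +
      ((column_inner m Tx Tx - column_inner m Tx (matrix_apply m T Tx)) +
        column_inner m y (matrix_apply m T y))"
    unfolding Ty unfolding y_def column_inner_diff_left column_inner_diff_right TTx_def by simp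
  show ?thesis
    unfolding Tx_def[symmetric] eq
    by (intro nonneg_add contr[of Tx] pos[of y]) (use contr[of x] in \<open>simp add: Tx_def\<close>)
qed

text \<open>The element \<open>K - z\<^sup>* z\<close> is positive, so it is \<open>k\<^sup>2\<close> with \<open>k\<close> self-adjoint, and the difference in
question is \<open>(k x)\<^sup>* (k x)\<close>.\<close>

lemma nonneg_star_mult_mult_self:
  fixes x z :: "'b::cstar_algebra"
  assumes "(norm z)\<^sup>2 \<le> K"
  shows "nonneg (K *\<^sub>R (star x * x) - star (z * x) * (z * x))"
proof -
  have "0 \<le> K"
    using assms by (smt (verit) zero_le_power2)
  then have "nonneg (K *\<^sub>R 1 - star z * z)"
    using assms
    by (intro nonnegI[where t = K])
       (simp_all add: star_diff star_scaleR star_mult star_star norm_star_mult_self)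
  then obtain k where k: "nonneg k" "k * k = K *\<^sub>R 1 - star z * z"
    by (rule nonneg_sqrt)
  have "star (k * x) * (k * x) = star x * (k * k) * x"
    by (simp add: star_mult nonneg_star[OF k(1)] mult.assoc)
  also have "\<dots> = K *\<^sub>R (star x * x) - star (z * x) * (z * x)"
    unfolding k(2) by (simp add: star_mult left_diff_distrib right_diff_distrib mult.assoc)
  finally show ?thesis
    using nonneg_star_mult_self[of "k * x"] by simp
qed

text \<open>The Cauchy-Schwarz inequality for sums of \<open>m\<close> terms: twice the difference is the sum of all
\<open>(y\<^sub>i - y\<^sub>j)\<^sup>* (y\<^sub>i - y\<^sub>j)\<close>.\<close>

lemma nonneg_sum_star_mult_sum:
  fixes y :: "nat \<Rightarrow> 'b::cstar_algebra"
  shows "nonneg (real m *\<^sub>R (\<Sum>i<m. star (y i) * y i) - star (\<Sum>i<m. y i) * (\<Sum>i<m. y i))"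
proof -
  define X where "X = real m *\<^sub>R (\<Sum>i<m. star (y i) * y i)"
  define W where "W = star (\<Sum>i<m. y i) * (\<Sum>i<m. y i)"
  have "(\<Sum>i<m. \<Sum>j<m. star (y i - y j) * (y i - y j)) =
      (\<Sum>i<m. \<Sum>j<m. star (y i) * y i) + (\<Sum>i<m. \<Sum>j<m. star (y j) * y j)
      - (\<Sum>i<m. \<Sum>j<m. star (y i) * y j) - (\<Sum>i<m. \<Sum>j<m. star (y j) * y i)"
    by (simp add: star_diff algebra_simps sum.distrib sum_subtractf)
  also have "(\<Sum>i<m. \<Sum>j<m. star (y i) * y i) = real m *\<^sub>R (\<Sum>i<m. star (y i) * y i)"
    by (simp add: sum_constant_scaleR scaleR_sum_right)
  also have "(\<Sum>i<m. \<Sum>j<m. star (y j) * y j) = real m *\<^sub>R (\<Sum>i<m. star (y i) * y i)"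
    by (simp add: sum_constant_scaleR)
  also have "(\<Sum>i<m. \<Sum>j<m. star (y j) * y i) = star (\<Sum>i<m. y i) * (\<Sum>i<m. y i)"
    by (subst sum.swap) (simp add: star_sum sum_product)
  also have "(\<Sum>i<m. \<Sum>j<m. star (y i) * y j) = star (\<Sum>i<m. y i) * (\<Sum>i<m. y i)"
    by (simp add: star_sum sum_product)
  finally have sum_eq: "(\<Sum>i<m. \<Sum>j<m. star (y i - y j) * (y i - y j)) = X + X - W - W"
    unfolding X_def W_def .
  have "X - W = (1/2) *\<^sub>R (\<Sum>i<m. \<Sum>j<m. star (y i - y j) * (y i - y j))"
  proof -
    have "X + X - W - W = 2 *\<^sub>R (X - W)"
      by (simp add: scaleR_2)
    then show ?thesis
      by (simp add: sum_eq)
  qed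
  then show ?thesis
    by (simp add: X_def W_def nonneg_scaleR nonneg_sum nonneg_star_mult_self)
qed

lemma row_bounded:
  fixes z :: "nat \<Rightarrow> 'b::cstar_algebra"
  shows "\<exists>C\<ge>0. \<forall>x. nonneg (C *\<^sub>R column_inner m x x
    - star (\<Sum>i<m. z i * x i) * (\<Sum>i<m. z i * x i))"
proof (intro exI[of _ "real m * (\<Sum>i<m. (norm (z i))\<^sup>2)"] conjI allI)
  fix x :: "nat \<Rightarrow> 'b"
  let ?K = "\<Sum>i<m. (norm (z i))\<^sup>2"
  have "nonneg (?K *\<^sub>R (star (x i) * x i) - star (z i * x i) * (z i * x i))" if "i < m" for i
    using that by (intro nonneg_star_mult_mult_self member_le_sum) auto
  then have "nonneg (real m *\<^sub>R (\<Sum>i<m. ?K *\<^sub>R (star (x i) * x i) - star (z i * x i) * (z i * x i)))"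
    by (intro nonneg_scaleR nonneg_sum) auto
  from nonneg_add[OF this nonneg_sum_star_mult_sum[of m "\<lambda>i. z i * x i"]]
  show "nonneg ((real m * ?K) *\<^sub>R column_inner m x x
      - star (\<Sum>i<m. z i * x i) * (\<Sum>i<m. z i * x i))"
    by (simp add: column_inner_def sum_subtractf scaleR_diff_right scaleR_sum_right[symmetric])
qed (simp add: sum_nonneg)

text \<open>A Gram matrix over an arbitrary finite index set is a Gram matrix over \<open>m\<close> indices, i.e. \<open>P = Z\<^sup>* Z\<close> has
a square root in \<open>M\<^sub>m(B)\<close>. For large \<open>C\<close> the matrix \<open>T = 1 - P/C\<close> satisfies \<open>0 \<le> T \<le> 1\<close> as a form on
\<open>B\<^sup>m\<close>. Hence applying \<open>T\<close> does not increase the length of a column, and as the columns of \<open>T\<^sup>k\<close> arise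
from unit vectors, their entries have norm at most \<open>1\<close>. So the series for \<open>\<surd>(1 - T) = \<surd>(P/C)\<close>
converges.\<close>

lemma positive_matrix_gram:
  fixes Z :: "'s \<Rightarrow> nat \<Rightarrow> 'b::cstar_algebra"
  assumes "finite S"
  shows "positive_matrix m (\<lambda>i j. \<Sum>s\<in>S. star (Z s i) * Z s j)"
proof -
  define P where "P = (\<lambda>i j. \<Sum>s\<in>S. star (Z s i) * Z s j)"
  define Zx where "Zx = (\<lambda>s x. \<Sum>i<m. Z s i * x i)"
  have "\<forall>s. \<exists>C\<ge>0. \<forall>x. nonneg (C *\<^sub>R column_inner m x x - star (Zx s x) * Zx s x)"
    unfolding Zx_def using row_bounded by blast
  then obtain c where c: "\<And>s. c s \<ge> 0"
      "\<And>s x. nonneg (c s *\<^sub>R column_inner m x x - star (Zx s x) * Zx s x)"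
    by metis
  define C where "C = (\<Sum>s\<in>S. c s) + 1"
  have C: "C > 0"
    unfolding C_def using c(1) by (intro add_nonneg_pos sum_nonneg) auto
  define Q where "Q x = (\<Sum>s\<in>S. star (Zx s x) * Zx s x)" for x
  have Q_bound: "nonneg (C *\<^sub>R column_inner m x x - Q x)" for x
  proof -
    have "C *\<^sub>R column_inner m x x - Q x =
        (\<Sum>s\<in>S. c s *\<^sub>R column_inner m x x - star (Zx s x) * Zx s x) + column_inner m x x"
      by (simp add: C_def Q_def scaleR_add_left scaleR_sum_left sum_subtractf)
    then show ?thesis
      using c(2) by (simp add: nonneg_add nonneg_sum column_inner_def nonneg_star_mult_self)
  qed
  define T where "T = (\<lambda>i j. (if i = j then 1 else 0) - (1/C) *\<^sub>R P i j)"
  have T: "star (T i j) = T j i" for i j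
    by (simp add: T_def P_def star_diff star_scaleR star_sum star_mult star_star)
  have TQ: "column_inner m x (matrix_apply m T x) = column_inner m x x - (1/C) *\<^sub>R Q x" for x
  proof -
    have "matrix_apply m T x i = x i - (1/C) *\<^sub>R (\<Sum>j<m. P i j * x j)" if "i < m" for i
      using that by (simp add: matrix_apply_def T_def left_diff_distrib sum_subtractf scaleR_sum_right
          if_distrib[where f = "\<lambda>x. x * _"] cong: if_cong)
    then have "column_inner m x (matrix_apply m T x) =
        column_inner m x x - (1/C) *\<^sub>R (\<Sum>i<m. star (x i) * (\<Sum>j<m. P i j * x j))"
      by (simp add: column_inner_def right_diff_distrib sum_subtractf scaleR_sum_right[symmetric])
    also have "(\<Sum>i<m. star (x i) * (\<Sum>j<m. P i j * x j)) = Q x"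
    proof -
      have "(\<Sum>i<m. star (x i) * (\<Sum>j<m. P i j * x j)) =
          (\<Sum>i<m. \<Sum>j<m. \<Sum>s\<in>S. star (Z s i * x i) * (Z s j * x j))"
        by (simp add: P_def sum_distrib_left sum_distrib_right star_mult mult.assoc)
      also have "\<dots> = (\<Sum>i<m. \<Sum>s\<in>S. \<Sum>j<m. star (Z s i * x i) * (Z s j * x j))"
        by (intro sum.cong refl sum.swap)
      also have "\<dots> = (\<Sum>s\<in>S. \<Sum>i<m. \<Sum>j<m. star (Z s i * x i) * (Z s j * x j))"
        by (rule sum.swap)
      also have "\<dots> = Q x"
        by (simp add: Q_def Zx_def star_sum sum_product)
      finally show ?thesis .
    qed
    finally show ?thesis .
  qed
  have pos: "nonneg (column_inner m x (matrix_apply m T x))" for x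
  proof -
    have "column_inner m x (matrix_apply m T x) = (1/C) *\<^sub>R (C *\<^sub>R column_inner m x x - Q x)"
      using C by (simp add: TQ scaleR_diff_right)
    then show ?thesis
      using Q_bound C by (simp add: nonneg_scaleR)
  qed
  have contr: "nonneg (column_inner m x x - column_inner m x (matrix_apply m T x))" for x
    using C by (simp add: TQ Q_def nonneg_scaleR nonneg_sum nonneg_star_mult_self)
  define col where "col k j = (\<lambda>i. matrix_power m T k i j)" for k j
  have col_Suc: "col (Suc k) j = matrix_apply m T (col k j)" for k j
    by (rule ext) (simp add: col_def matrix_apply_def)
  have col_bound: "nonneg (1 - column_inner m (col k j) (col k j))" if "j < m" for k j
  proof (induction k)
    case 0
    have "column_inner m (col 0 j) (col 0 j) = 1"
      using that by (simp add: column_inner_def col_def if_distrib[where f = star]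
          if_distrib[where f = "\<lambda>x. _ * x"] cong: if_cong)
    then show ?case by simp
  next
    case (Suc k)
    from nonneg_add[OF Suc positive_contraction_shrinks[OF T pos contr, of "col k j"]]
    show ?case by (simp add: col_Suc)
  qed
  have entry_bound: "norm (matrix_power m T k i j) \<le> 1" if "i < m" "j < m" for k i j
  proof -
    let ?p = "\<lambda>i. star (col k j i) * col k j i"
    have "norm (?p i) \<le> norm (?p i + ((\<Sum>l\<in>{..<m} - {i}. ?p l)
        + (1 - column_inner m (col k j) (col k j))))"
      using col_bound[OF that(2)]
      by (intro norm_mono nonneg_add nonneg_sum nonneg_star_mult_self) auto
    also have "?p i + ((\<Sum>l\<in>{..<m} - {i}. ?p l) + (1 - column_inner m (col k j) (col k j))) = 1"
      using sum.remove[of "{..<m}" i ?p] that(1) by (simp add: column_inner_def)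
    finally have "(norm (col k j i))\<^sup>2 \<le> 1"
      using norm_one_le[where 'b = 'b] by (simp add: norm_star_mult_self)
    then show ?thesis
      by (simp add: power_le_one_iff col_def)
  qed
  define R where "R = (\<lambda>i j. \<Sum>k. sqrt_coeff k *\<^sub>R matrix_power m T k i j)"
  have R_star: "star (R i j) = R j i" if "i < m" "j < m" for i j
    unfolding R_def using star_matrix_power[of m T i j] T that
    by (subst bounded_linear.suminf[OF bounded_linear_star])
       (auto simp: star_scaleR intro!: summable_norm_cancel[OF summable_sqrt_series] entry_bound)
  have "P i j = (\<Sum>k<m. star (sqrt C *\<^sub>R R k i) * (sqrt C *\<^sub>R R k j))" if "i < m" "j < m" for i j
  proof -
    have "(\<Sum>k<m. star (sqrt C *\<^sub>R R k i) * (sqrt C *\<^sub>R R k j)) = C *\<^sub>R (\<Sum>k<m. R i k * R k j)"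
      using that C by (simp add: star_scaleR R_star scaleR_sum_right)
    also have "(\<Sum>k<m. R i k * R k j) = (if i = j then 1 else 0) - T i j"
      unfolding R_def using entry_bound that by (rule matrix_sqrt_one_minus)
    also have "C *\<^sub>R \<dots> = P i j"
      using C by (simp add: T_def)
    finally show ?thesis ..
  qed
  then show ?thesis
    unfolding positive_matrix_def P_def by (intro exI[of _ "\<lambda>k i. sqrt C *\<^sub>R R k i"]) auto
qed

section \<open>Completely positive maps into matrix algebras\<close>

lemma clinear_iff:
  "Vector_Spaces.linear (*\<^sub>C) (*\<^sub>C) f \<longleftrightarrow>
    (\<forall>x y. f (x + y) = f x + f y) \<and> (\<forall>c x. f (c *\<^sub>C x) = c *\<^sub>C f x)"
  unfolding Vector_Spaces.linear_iff
  by (simp add: complex_vector.vector_space_axioms)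

lemma completely_positiveD:
  assumes "completely_positive f"
  shows "f (x + y) = f x + f y" "f (c *\<^sub>C x) = c *\<^sub>C f x" "continuous_on UNIV f"
    "positive_matrix m X \<Longrightarrow> positive_matrix m (\<lambda>i j. f (X i j))"
  using assms unfolding completely_positive_def clinear_iff by blast+

lemma continuous_on_rows_of:
  "continuous_on UNIV (rows_of :: ('a::topological_space, 'n::finite) sqmat \<Rightarrow> _)"
proof -
  have "rows_of ` (rows_of -` U) = U" for U :: "('a^'n^'n) set"
    by (auto simp: image_iff) (metis of_rows_inverse UNIV_I)
  then show ?thesis
    unfolding continuous_on_open_vimage[OF open_UNIV] open_sqmat.rep_eq Int_UNIV_right by simp
qed

lemma continuous_on_entry:
  "continuous_on UNIV (\<lambda>X :: ('a::topological_space, 'n::finite) sqmat. entry X i j)"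
  unfolding entry.rep_eq by (intro continuous_intros continuous_on_rows_of)

lemma continuous_on_Mat:
  fixes f :: "'c::topological_space \<Rightarrow> 'n::finite \<Rightarrow> 'n \<Rightarrow> 'a::topological_space"
  assumes "\<And>i j. continuous_on UNIV (\<lambda>x. f x i j)"
  shows "continuous_on UNIV (\<lambda>x. Mat (f x))"
proof -
  have cont: "continuous_on UNIV (\<lambda>x. rows_of (Mat (f x)))"
    unfolding Mat.rep_eq by (intro continuous_intros assms)
  have "(\<lambda>x. Mat (f x)) -` S = (\<lambda>x. rows_of (Mat (f x))) -` (rows_of ` S)" for S
    by (auto simp: rows_of_inject)
  then show ?thesis
    using cont by (simp add: continuous_on_open_vimage open_sqmat.rep_eq)
qed

lemma entry_sum:
  "entry (\<Sum>p\<in>S. f p :: ('a::complex_star_algebra, 'n::finite) sqmat) i j = (\<Sum>p\<in>S. entry (f p) i j)"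
  by (induction S rule: infinite_finite_induct) (simp_all add: entry_zero entry_plus)

text \<open>The map \<open>a \<mapsto> [a]\<^sub>i\<^sub>j\<close> into \<open>M\<^sub>n(A)\<close> with all entries equal is \<open>n\<close> times a *-homomorphism, since the
all-ones matrix \<open>J\<close> has \<open>J\<^sup>2 = n J\<close>; whence the factor \<open>1 / \<surd>n\<close> in the new Gram vectors.\<close>

lemma positive_matrix_constant_blocks:
  fixes X :: "nat \<Rightarrow> nat \<Rightarrow> 'a::complex_star_algebra"
  assumes "positive_matrix m X"
  shows "positive_matrix m (\<lambda>k l. Mat (\<lambda>_ _ :: 'n::finite. X k l))"
proof -
  obtain Y where Y: "\<And>k l. k < m \<Longrightarrow> l < m \<Longrightarrow> X k l = (\<Sum>p<m. star (Y p k) * Y p l)"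
    using assms unfolding positive_matrix_def by blast
  define c where "c = 1 / sqrt (real CARD('n))"
  define Z :: "nat \<Rightarrow> nat \<Rightarrow> ('a, 'n) sqmat" where "Z p k = Mat (\<lambda>_ _. c *\<^sub>R Y p k)" for p k
  have c: "real CARD('n) * (c * c) = 1"
    by (simp add: c_def)
  have "Mat (\<lambda>_ _. X k l) = (\<Sum>p<m. star (Z p k) * Z p l)" if "k < m" "l < m" for k l
  proof -
    have "entry (star (Z p k) * Z p l) i j = star (Y p k) * Y p l" for p i j
    proof -
      have "entry (star (Z p k) * Z p l) i j = (real CARD('n) * (c * c)) *\<^sub>R (star (Y p k) * Y p l)"
        by (simp add: entry_times entry_star Z_def star_scaleR sum_constant_scaleR)
      then show ?thesis by (simp only: c scaleR_one)
    qed
    then show ?thesis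
      using that by (simp add: sqmat_eq_iff entry_sum Y)
  qed
  then show ?thesis
    unfolding positive_matrix_def by blast
qed

lemma completely_positive_of_completely_n_positive:
  fixes \<rho> :: "'n::finite \<Rightarrow> 'n \<Rightarrow> 'a::{complex_star_algebra, topological_space} \<Rightarrow> 'b::cstar_algebra"
  assumes "completely_n_positive \<rho>"
  shows "completely_positive (\<lambda>a. Mat (\<lambda>i j. \<rho> i j a))"
proof -
  have lin: "\<rho> i j (x + y) = \<rho> i j x + \<rho> i j y" "\<rho> i j (c *\<^sub>C x) = c *\<^sub>C \<rho> i j x"
    and cont: "continuous_on UNIV (\<rho> i j)" for i j x y c
    using assms unfolding completely_n_positive_def clinear_iff by blast+
  have cp: "completely_positive (\<lambda>X :: ('a, 'n) sqmat. Mat (\<lambda>i j. \<rho> i j (entry X i j)))"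
    using assms unfolding completely_n_positive_def by blast
  show ?thesis
    unfolding completely_positive_def clinear_iff
  proof (intro conjI allI impI)
    show "continuous_on UNIV (\<lambda>a. Mat (\<lambda>i j. \<rho> i j a))"
      by (intro continuous_on_Mat cont)
    fix m :: nat and X :: "nat \<Rightarrow> nat \<Rightarrow> 'a"
    assume "positive_matrix m X"
    from completely_positiveD(4)[OF cp positive_matrix_constant_blocks[OF this]]
    show "positive_matrix m (\<lambda>k l. Mat (\<lambda>i j. \<rho> i j (X k l)))"
      by simp
  qed (simp_all add: sqmat_eq_iff entry_plus entry_scaleC lin)
qed

lemma positive_matrix_sqmat_gram:
  fixes W :: "nat \<Rightarrow> nat \<Rightarrow> ('b::complex_star_algebra, 'n::finite) sqmat"
  assumes "positive_matrix m W"
  obtains Z :: "nat \<times> 'n \<Rightarrow> nat \<Rightarrow> 'n \<Rightarrow> 'b"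
  where "\<And>k l i j. k < m \<Longrightarrow> l < m \<Longrightarrow>
    entry (W k l) i j = (\<Sum>s\<in>{..<m} \<times> UNIV. star (Z s k i) * Z s l j)"
proof -
  obtain Y where Y: "\<And>k l. k < m \<Longrightarrow> l < m \<Longrightarrow> W k l = (\<Sum>p<m. star (Y p k) * Y p l)"
    using assms unfolding positive_matrix_def by blast
  show ?thesis
  proof (rule that[of "\<lambda>s k i. entry (Y (fst s) k) (snd s) i"])
    fix k l i j assume "k < m" "l < m"
    then show "entry (W k l) i j = (\<Sum>s\<in>{..<m} \<times> UNIV.
        star (entry (Y (fst s) k) (snd s) i) * entry (Y (fst s) l) (snd s) j)"
      by (simp add: Y entry_sum entry_times entry_star sum.cartesian_product split_def)
  qed
qed

text \<open>Taking the entry \<open>(i, i)\<close> of every block of \<open>Y\<^sup>* Y\<close> in \<open>M\<^sub>m(M\<^sub>n(B))\<close> gives a Gram matrix with \<open>m n\<close>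
summands, and complete positivity
asks for \<open>m\<close> summands; the square root in \<open>M\<^sub>m(B)\<close> bridges this gap.\<close>

lemma completely_positive_diagonal_entry:
  fixes \<psi> :: "'a::{complex_star_algebra, topological_space} \<Rightarrow> ('b::cstar_algebra, 'n::finite) sqmat"
  assumes "completely_positive \<psi>"
  shows "completely_positive (\<lambda>a. entry (\<psi> a) i i)"
  unfolding completely_positive_def clinear_iff
proof (intro conjI allI impI)
  show "continuous_on UNIV (\<lambda>a. entry (\<psi> a) i i)"
    using continuous_on_compose2[OF continuous_on_entry completely_positiveD(3)[OF assms]] by blast
  fix m :: nat and X :: "nat \<Rightarrow> nat \<Rightarrow> 'a"
  assume "positive_matrix m X"
  from completely_positiveD(4)[OF assms this]
  obtain Z :: "nat \<times> 'n \<Rightarrow> nat \<Rightarrow> 'n \<Rightarrow> 'b" where Z: "\<And>k l i j. k < m \<Longrightarrow> l < m \<Longrightarrow>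
      entry (\<psi> (X k l)) i j = (\<Sum>s\<in>{..<m} \<times> UNIV. star (Z s k i) * Z s l j)"
    by (rule positive_matrix_sqmat_gram) blast
  have "positive_matrix m (\<lambda>k l. \<Sum>s\<in>{..<m} \<times> UNIV. star (Z s k i) * Z s l i)"
    by (rule positive_matrix_gram[where Z = "\<lambda>s k. Z s k i"]) simp
  then show "positive_matrix m (\<lambda>k l. entry (\<psi> (X k l)) i i)"
    unfolding positive_matrix_def by (simp add: Z)
qed (simp_all add: completely_positiveD[OF assms] entry_plus entry_scaleC)

lemma completely_positive_scaleR:
  fixes f :: "'a::{complex_star_algebra, topological_space} \<Rightarrow> 'b::cstar_algebra"
  assumes "completely_positive f" "0 \<le> r"
  shows "completely_positive (\<lambda>a. r *\<^sub>R f a)"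
  unfolding completely_positive_def clinear_iff
proof (intro conjI allI impI)
  show "continuous_on UNIV (\<lambda>a. r *\<^sub>R f a)"
    by (intro continuous_intros completely_positiveD[OF assms(1)])
  fix m :: nat and X :: "nat \<Rightarrow> nat \<Rightarrow> 'a"
  assume "positive_matrix m X"
  from completely_positiveD(4)[OF assms(1) this]
  obtain Y where Y: "\<And>k l. k < m \<Longrightarrow> l < m \<Longrightarrow> f (X k l) = (\<Sum>p<m. star (Y p k) * Y p l)"
    unfolding positive_matrix_def by blast
  have "r *\<^sub>R f (X k l) = (\<Sum>p<m. star (sqrt r *\<^sub>R Y p k) * (sqrt r *\<^sub>R Y p l))"
    if "k < m" "l < m" for k l
    using that assms(2) by (simp add: Y star_scaleR scaleR_sum_right)
  then show "positive_matrix m (\<lambda>k l. r *\<^sub>R f (X k l))"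
    unfolding positive_matrix_def by (intro exI[of _ "\<lambda>p k. sqrt r *\<^sub>R Y p k"]) blast
qed (simp_all add: completely_positiveD[OF assms(1)] scaleR_scaleC scaleC_add_right
      scaleC_scaleC mult.commute)

lemma pure_cp_convex_combination:
  fixes \<sigma> f g :: "'a::{complex_star_algebra, topological_space} \<Rightarrow> 'b::cstar_algebra"
  assumes "pure_cp \<sigma>" "\<sigma> 1 = 1"
    and f: "completely_positive f" "f 1 = 1" and g: "completely_positive g"
    and t: "0 < r" "0 < t" and eq: "\<And>a. \<sigma> a = r *\<^sub>R f a + t *\<^sub>R g a"
  shows "f a = \<sigma> a"
proof (cases "(1 :: 'b) = 0")
  case True
  then have "x = 0" for x :: 'b
    by (metis mult_1 mult_zero_left)
  then show ?thesis by metis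
next
  case False
  have "completely_positive (\<lambda>a. r *\<^sub>R f a)" "completely_positive (\<lambda>a. \<sigma> a - r *\<^sub>R f a)"
    using t f(1) g by (simp_all add: eq completely_positive_scaleR)
  then obtain \<alpha> where \<alpha>: "\<And>a. r *\<^sub>R f a = \<alpha> *\<^sub>R \<sigma> a"
    using assms(1) unfolding pure_cp_def cp_le_def by blast
  from \<alpha>[of 1] have "\<alpha> = r"
    using False by (simp add: assms(2) f(2))
  then show ?thesis
    using \<alpha>[of a] t by simp
qed

text \<open>Finitely many vectors of the KSGNS module: \<open>Z\<^sub>k\<^sub>i\<close> stands for \<open>\<Phi>(a\<^sub>k) V e\<^sub>i\<close>, realised in a power of \<open>B\<close>.\<close>

lemma completely_positive_gram:
  fixes \<psi> :: "'a::{complex_star_algebra, topological_space} \<Rightarrow> ('b::cstar_algebra, 'n::finite) sqmat"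
  assumes "completely_positive \<psi>"
  obtains Z :: "nat \<times> 'n \<Rightarrow> nat \<Rightarrow> 'n \<Rightarrow> 'b"
  where "\<And>k l i j. k < m \<Longrightarrow> l < m \<Longrightarrow>
    entry (\<psi> (star (a k) * a l)) i j = (\<Sum>s\<in>{..<m} \<times> UNIV. star (Z s k i) * Z s l j)"
proof -
  have "positive_matrix m (\<lambda>k l. star (a k) * a l)"
  proof (cases "m = 0")
    case False
    have "star (a k) * a l = (\<Sum>p<m. star (if p = 0 then a k else 0) * (if p = 0 then a l else 0))" for k l
      using False by (subst sum.remove[of _ 0]) auto
    then show ?thesis
      unfolding positive_matrix_def by (intro exI[of _ "\<lambda>p k. if p = 0 then a k else 0"]) blast
  qed (simp add: positive_matrix_def)
  from completely_positiveD(4)[OF assms this] show ?thesis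
    by (rule positive_matrix_sqmat_gram) (rule that)
qed

lemma completely_positive_entry_star:
  fixes \<psi> :: "'a::{complex_star_algebra, topological_space} \<Rightarrow> ('b::cstar_algebra, 'n::finite) sqmat"
  assumes "completely_positive \<psi>"
  shows "entry (\<psi> (star a)) j i = star (entry (\<psi> a) i j)"
proof -
  let ?a = "\<lambda>k::nat. if k = 0 then 1 else a"
  obtain Z :: "nat \<times> 'n \<Rightarrow> nat \<Rightarrow> 'n \<Rightarrow> 'b" where Z: "\<And>k l i j. k < 2 \<Longrightarrow> l < 2 \<Longrightarrow>
      entry (\<psi> (star (?a k) * ?a l)) i j = (\<Sum>s\<in>{..<2} \<times> UNIV. star (Z s k i) * Z s l j)"
    using completely_positive_gram[OF assms, where m = 2 and a = ?a] by blast
  from Z[of 0 1 i j] Z[of 1 0 j i] show ?thesis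
    by (simp add: star_sum star_mult star_star)
qed

text \<open>With \<open>\<xi>\<^sub>i = V e\<^sub>i\<close> the first expression is the square of the length of \<open>\<xi>\<^sub>i - u \<xi>\<^sub>j\<close>. If it vanishes then
\<open>\<xi>\<^sub>i = u \<xi>\<^sub>j\<close>, and pairing this equation with \<open>(b u\<^sup>*)\<^sup>* \<xi>\<^sub>i\<close> gives the second claim. Thus the
vectors obtained from \<open>1\<close>, \<open>u\<close> and \<open>(b u\<^sup>*)\<^sup>*\<close> are all that is needed.\<close>

lemma unital_cp_coincidence:
  fixes \<psi> :: "'a::{complex_star_algebra, topological_space} \<Rightarrow> ('b::cstar_algebra, 'n::finite) sqmat"
  assumes cp: "completely_positive \<psi>" and one: "\<psi> 1 = 1" and u: "star u * u = 1"
  shows "nonneg (2 *\<^sub>R 1 - entry (\<psi> u) i j - entry (\<psi> (star u)) j i)"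
    and "2 *\<^sub>R 1 - entry (\<psi> u) i j - entry (\<psi> (star u)) j i = 0 \<Longrightarrow>
      entry (\<psi> b) i j = entry (\<psi> (b * star u)) i i"
proof -
  let ?a = "\<lambda>k::nat. if k = 0 then 1 else if k = 1 then u else star (b * star u)"
  let ?S = "{..<3} \<times> (UNIV :: 'n set)"
  obtain Z :: "nat \<times> 'n \<Rightarrow> nat \<Rightarrow> 'n \<Rightarrow> 'b" where Z: "\<And>k l i j. k < 3 \<Longrightarrow> l < 3 \<Longrightarrow>
      entry (\<psi> (star (?a k) * ?a l)) i j = (\<Sum>s\<in>?S. star (Z s k i) * Z s l j)"
    using completely_positive_gram[OF cp, where m = 3 and a = ?a] by blast
  define w where "w s = Z s 0 i - Z s 1 j" for s
  have defect: "2 *\<^sub>R 1 - entry (\<psi> u) i j - entry (\<psi> (star u)) j i = (\<Sum>s\<in>?S. star (w s) * w s)"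
  proof -
    have "(\<Sum>s\<in>?S. star (w s) * w s) =
        (\<Sum>s\<in>?S. star (Z s 0 i) * Z s 0 i) - (\<Sum>s\<in>?S. star (Z s 0 i) * Z s 1 j)
        - (\<Sum>s\<in>?S. star (Z s 1 j) * Z s 0 i) + (\<Sum>s\<in>?S. star (Z s 1 j) * Z s 1 j)"
      unfolding sum_subtractf[symmetric] sum.distrib[symmetric]
      by (rule sum.cong) (simp_all add: w_def star_diff algebra_simps)
    then show ?thesis
      using Z[of 0 0 i i] Z[of 0 1 i j] Z[of 1 0 j i] Z[of 1 1 j j]
      by (simp add: u one entry_one scaleR_2)
  qed
  show "nonneg (2 *\<^sub>R 1 - entry (\<psi> u) i j - entry (\<psi> (star u)) j i)"
    unfolding defect by (intro nonneg_sum nonneg_star_mult_self)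
  assume "2 *\<^sub>R 1 - entry (\<psi> u) i j - entry (\<psi> (star u)) j i = 0"
  then have "(\<Sum>s\<in>?S. star (w s) * w s) = 0"
    unfolding defect .
  then have "w s = 0" if "s \<in> ?S" for s
    using that by (intro sum_star_mult_eq_0D[of ?S w s]) simp_all
  then have "(\<Sum>s\<in>?S. star (Z s 2 i) * Z s 0 i) = (\<Sum>s\<in>?S. star (Z s 2 i) * Z s 1 j)"
    by (intro sum.cong) (simp_all add: w_def)
  then show "entry (\<psi> b) i j = entry (\<psi> (b * star u)) i i"
    using Z[of 2 0 i i] Z[of 2 1 i j] by (simp add: star_star mult.assoc u)
qed

section \<open>Extremality\<close>

theorem corollary3p4:
  fixes \<rho> :: "'n::finite \<Rightarrow> 'n \<Rightarrow> 'a::locally_cstar_algebra \<Rightarrow> 'b::cstar_algebra"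
  assumes "completely_n_positive \<rho>"
    and "\<And>i. completely_positive (\<rho> i i)"
    and "\<And>i. pure_cp (\<rho> i i)"
    and "\<And>i. \<rho> i i 1 = 1"
    and "\<And>i j. unitarily_equivalent_cp TYPE('h::complex_vector) (\<rho> i i) (\<rho> j j)"
    and "\<And>i j. i \<noteq> j \<Longrightarrow> \<rho> i j 1 = 0"
    and "\<And>i j. i \<noteq> j \<Longrightarrow> \<exists>u. unitary u \<and> \<rho> i j u = 1"
  shows "(\<lambda>a. Mat (\<lambda>i j. \<rho> i j a)) extreme_point_of
           {\<psi> :: 'a \<Rightarrow> ('b, 'n) sqmat. completely_positive \<psi> \<and> \<psi> 1 = 1}"
proof -
  define \<phi> where "\<phi> = (\<lambda>a. Mat (\<lambda>i j. \<rho> i j a))"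
  have \<phi>: "completely_positive \<phi>"
    unfolding \<phi>_def using assms(1) by (rule completely_positive_of_completely_n_positive)
  moreover have "\<phi> 1 = 1"
    using assms(4,6) by (simp add: \<phi>_def sqmat_eq_iff entry_one)
  moreover have "\<psi>\<^sub>1 = \<psi>\<^sub>2"
    if \<psi>: "completely_positive \<psi>\<^sub>1" "\<psi>\<^sub>1 1 = 1" "completely_positive \<psi>\<^sub>2" "\<psi>\<^sub>2 1 = 1"
      and t: "0 < t" "t < 1" and eq: "\<phi> = (1 - t) *\<^sub>R \<psi>\<^sub>1 + t *\<^sub>R \<psi>\<^sub>2" for \<psi>\<^sub>1 \<psi>\<^sub>2 t
  proof -
    have entries: "\<rho> i j a = (1 - t) *\<^sub>R entry (\<psi>\<^sub>1 a) i j + t *\<^sub>R entry (\<psi>\<^sub>2 a) i j" for i j a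
    proof -
      have "\<rho> i j a = entry (\<phi> a) i j" by (simp add: \<phi>_def)
      then show ?thesis
        by (simp add: eq scaleR_fun_def entry_plus entry_scaleR)
    qed
    have diag: "entry (\<psi>\<^sub>1 a) i i = \<rho> i i a" "entry (\<psi>\<^sub>2 a) i i = \<rho> i i a" for i a
    proof -
      note cp = completely_positive_diagonal_entry[OF \<psi>(1), of i]
        completely_positive_diagonal_entry[OF \<psi>(3), of i]
      show "entry (\<psi>\<^sub>1 a) i i = \<rho> i i a"
        by (rule pure_cp_convex_combination[where r = "1 - t" and t = t, OF assms(3,4) cp(1) _ cp(2)])
           (use t entries in \<open>simp_all add: \<psi> entry_one\<close>)
      show "entry (\<psi>\<^sub>2 a) i i = \<rho> i i a"
        by (rule pure_cp_convex_combination[where r = t and t = "1 - t", OF assms(3,4) cp(2) _ cp(1)])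
           (use t entries in \<open>simp_all add: \<psi> entry_one add.commute\<close>)
    qed
    have "entry (\<psi>\<^sub>1 b) i j = entry (\<psi>\<^sub>2 b) i j" for i j b
    proof (cases "i = j")
      case False
      then obtain u where u: "star u * u = 1" "\<rho> i j u = 1"
        using assms(7)[OF False] unfolding unitary_def by blast
      have u': "\<rho> j i (star u) = 1"
        using completely_positive_entry_star[OF \<phi>, of u j i] by (simp add: \<phi>_def u)
      define d where "d \<psi> = 2 *\<^sub>R 1 - entry (\<psi> u) i j - entry (\<psi> (star u)) j i"
        for \<psi> :: "'a \<Rightarrow> ('b, 'n) sqmat"
      have pos: "nonneg ((1 - t) *\<^sub>R d \<psi>\<^sub>1)" "nonneg (t *\<^sub>R d \<psi>\<^sub>2)"
        unfolding d_def using t \<psi> u by (auto intro!: nonneg_scaleR unital_cp_coincidence(1))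
      have "(1 - t) *\<^sub>R d \<psi>\<^sub>1 + t *\<^sub>R d \<psi>\<^sub>2 = 2 *\<^sub>R 1 - \<rho> i j u - \<rho> j i (star u)"
        unfolding d_def entries by (simp add: algebra_simps)
      also have "\<dots> = 0"
        by (simp add: u u' scaleR_2)
      finally have sum0: "(1 - t) *\<^sub>R d \<psi>\<^sub>1 + t *\<^sub>R d \<psi>\<^sub>2 = 0" .
      then have "- ((1 - t) *\<^sub>R d \<psi>\<^sub>1) = t *\<^sub>R d \<psi>\<^sub>2"
        by (rule minus_unique)
      then have "(1 - t) *\<^sub>R d \<psi>\<^sub>1 = 0"
        using pos by (intro nonneg_antisym) simp_all
      with sum0 have "d \<psi>\<^sub>1 = 0" "d \<psi>\<^sub>2 = 0"
        using t by simp_all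
      then have "entry (\<psi>\<^sub>1 b) i j = entry (\<psi>\<^sub>1 (b * star u)) i i"
          "entry (\<psi>\<^sub>2 b) i j = entry (\<psi>\<^sub>2 (b * star u)) i i"
        unfolding d_def using \<psi> u(1) by (auto intro!: unital_cp_coincidence(2))
      then show ?thesis
        by (simp add: diag)
    qed (simp add: diag)
    then show ?thesis
      by (simp add: fun_eq_iff sqmat_eq_iff)
  qed
  ultimately show ?thesis
    unfolding \<phi>_def[symmetric] extreme_point_of_def in_segment by blast
qed

end
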